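(* Fix an integer $k\ge3$. Let $G_N$ be a uniformly random $k$-regular graph on $N$ vertices. There is a constant $C$ depending only on $k$ such that, with probability tending to $1$ as $N\to\infty$, the maximum vertex flow of $G_N$ under geodesic routing satisfies $$M_v(N)\le k^{C}N(\log_k N)^3+o\big(N(\log_k N)^3\big).$$
   Context: Geodesic routing and vertex flow on a finite connected graph: $d$ denotes the hop (graph) metric; for each unordered pair of distinct vertices $\{v,w\}$ one unit of flow is sent from $v$ to $w$ along shortest paths, where at each vertex $v'$ on a shortest path the flow arriving at $v'$ is split equally among the neighbors $x$ of $v'$ with $d(x,w)=d(v',w)-1$. The vertex flow $T(u)$ of a vertex $u$ is the total flow passing through $u$ (including pairs having $u$ as an endpoint), and the maximum vertex flow is $M_v=\max_u T(u)$. *)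

theory Defs
  imports "HOL-Probability.Probability" "HOL-Library.Landau_Symbols"
begin

definition all_edges :: "nat \<Rightarrow> nat set set" where
  "all_edges N = {{u, v} | u v. u < N \<and> v < N \<and> u \<noteq> v}"

definition regular_graphs :: "nat \<Rightarrow> nat \<Rightarrow> nat set set set" where
  "regular_graphs k N =
     {E. E \<subseteq> all_edges N \<and> (\<forall>u<N. card {e\<in>E. u \<in> e} = k)}"

fun is_walk :: "nat set set \<Rightarrow> nat list \<Rightarrow> bool" where
  "is_walk E [] = False"
| "is_walk E [x] = True"
| "is_walk E (x # y # xs) = ({x, y} \<in> E \<and> is_walk E (y # xs))"

definition reach :: "nat set set \<Rightarrow> nat \<Rightarrow> nat \<Rightarrow> bool" where
  "reach E u w = (\<exists>xs. is_walk E xs \<and> hd xs = u \<and> last xs = w)"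

definition hop_dist :: "nat set set \<Rightarrow> nat \<Rightarrow> nat \<Rightarrow> nat" where
  "hop_dist E u w =
     (LEAST n. \<exists>xs. is_walk E xs \<and> hd xs = u \<and> last xs = w \<and> length xs = Suc n)"

definition next_hops :: "nat \<Rightarrow> nat set set \<Rightarrow> nat \<Rightarrow> nat \<Rightarrow> nat set" where
  "next_hops N E w y = {z. z < N \<and> {y, z} \<in> E \<and> hop_dist E z w + 1 = hop_dist E y w}"

text \<open>step_flow N E v w t x: amount of the unit flow from v to w sitting at x after t steps
  (flow arriving at a vertex is split equally among its next hops towards w).\<close>

fun step_flow :: "nat \<Rightarrow> nat set set \<Rightarrow> nat \<Rightarrow> nat \<Rightarrow> nat \<Rightarrow> nat \<Rightarrow> real" where
  "step_flow N E v w 0 x = (if x = v then 1 else 0)"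
| "step_flow N E v w (Suc t) x =
     (\<Sum>y<N. if x \<in> next_hops N E w y
              then step_flow N E v w t y / real (card (next_hops N E w y)) else 0)"

text \<open>Flow through x of the unit sent from v to w along shortest paths
  (including the endpoints). Pairs that are not connected send nothing.\<close>

definition pair_flow :: "nat \<Rightarrow> nat set set \<Rightarrow> nat \<Rightarrow> nat \<Rightarrow> nat \<Rightarrow> real" where
  "pair_flow N E v w x =
     (if reach E v w then (\<Sum>t\<le>hop_dist E v w. step_flow N E v w t x) else 0)"

text \<open>Vertex flow: one unit per unordered pair {v,w}, sent from the smaller label to the larger.\<close>

definition vertex_flow :: "nat \<Rightarrow> nat set set \<Rightarrow> nat \<Rightarrow> real" where
  "vertex_flow N E u = (\<Sum>w<N. \<Sum>v<w. pair_flow N E v w u)"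

definition max_vertex_flow :: "nat \<Rightarrow> nat set set \<Rightarrow> real" where
  "max_vertex_flow N E = Max (vertex_flow N E ` {..<N})"

end

theory Submission
  imports Defs "HOL-Real_Asymp.Real_Asymp"
begin

text \<open>A unit of flow from v to w meets u only if v and w lie in balls around u whose radii add up to
  d(v,w). Balls of radius t have size O((k-1)^t), so the pairs at distance at most D contribute
  O(D (k-1)^D) to the flow at u, and every other pair contributes at most 1. It therefore suffices to take
  (k-1)^D of order N (log N)^2 and to show that the expected number of pairs at distance more than D
  is O(N (log N)^2); Markov's inequality does the rest, with no further error term.

  The probability that d(v,w) exceeds D is estimated by switchings performed directly on simple
  regular graphs, xy, zw being replaced by xz, yw. An excess edge of the ball around v (one that
  closes a cycle) can be switched with almost any edge of the graph, whereas undoing this requires choosing two vertices of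
  the ball; hence a level whose ball has b vertices has j excess edges with probability at most
  (C b^2 / N)^j / j!. With probability 1 - O((log N)^2 / N) there are no excess edges until the ball
  has size of order log N, at most one per level until it has size N^(1/8), and polylogarithmically many per
  level after that, so that the ball grows by a factor k-1 per step up to constants. Two disjoint balls with
  boundaries of size about sqrt N log N can be connected by switching an edge leaving one ball with an
  edge leaving the other. There are so many ways to do so that graphs without an edge between the balls
  are superpolynomially rare.\<close>

section \<open>Balls and their growth\<close>

definition nbrs :: "nat set set \<Rightarrow> nat \<Rightarrow> nat set" where
  "nbrs E u = {y. {u, y} \<in> E}"

fun hop_ball :: "nat set set \<Rightarrow> nat \<Rightarrow> nat \<Rightarrow> nat set" where
  "hop_ball E v 0 = {v}"
| "hop_ball E v (Suc l) = hop_ball E v l \<union> (\<Union>x\<in>hop_ball E v l. nbrs E x)"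

definition touch :: "nat set set \<Rightarrow> nat set \<Rightarrow> nat" where
  "touch E A = card {e \<in> E. e \<inter> A \<noteq> {}}"

definition boundary :: "nat set set \<Rightarrow> nat set \<Rightarrow> (nat \<times> nat) set" where
  "boundary E A = {(a, b). a \<in> A \<and> b \<notin> A \<and> {a, b} \<in> E}"

text \<open>The number of edges touched by the ball of radius p + 1 but not by the one of radius p, minus the
  number of vertices at distance p + 2: the cycles closed at this level.\<close>

definition newexc :: "nat set set \<Rightarrow> nat \<Rightarrow> nat \<Rightarrow> int" where
  "newexc E v p = int (touch E (hop_ball E v (Suc p))) - int (touch E (hop_ball E v p))
     - (int (card (hop_ball E v (Suc (Suc p)))) - int (card (hop_ball E v (Suc p))))"

section \<open>Elementary calculus of balls in an arbitrary graph\<close>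

lemma mem_nbrs [simp]: "y \<in> nbrs E u \<longleftrightarrow> {u, y} \<in> E"
  by (simp add: nbrs_def)

declare hop_ball.simps(2) [simp del]

lemma mem_ball_Suc: "w \<in> hop_ball E v (Suc n) \<longleftrightarrow> w \<in> hop_ball E v n \<or> (\<exists>u\<in>hop_ball E v n. {u, w} \<in> E)"
  by (auto simp: hop_ball.simps)

lemma ball_mono_Suc: "hop_ball E v l \<subseteq> hop_ball E v (Suc l)"
  by (auto simp: mem_ball_Suc)

lemma ball_mono: "l \<le> m \<Longrightarrow> hop_ball E v l \<subseteq> hop_ball E v m"
  by (rule lift_Suc_mono_le[of "hop_ball E v"]) (auto simp: mem_ball_Suc)

lemma ball_edge: "\<lbrakk>x \<in> hop_ball E v l; {x, y} \<in> E\<rbrakk> \<Longrightarrow> y \<in> hop_ball E v (Suc l)"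
  by (auto simp: mem_ball_Suc)

lemma ball_trans: "\<lbrakk>y \<in> hop_ball E x m; z \<in> hop_ball E y n\<rbrakk> \<Longrightarrow> z \<in> hop_ball E x (m + n)"
  by (induction n arbitrary: z) (auto simp: mem_ball_Suc)

lemma ball_Cons: "\<lbrakk>{x, y} \<in> E; w \<in> hop_ball E y n\<rbrakk> \<Longrightarrow> w \<in> hop_ball E x (Suc n)"
  using ball_trans[of y E x 1 w n] by (simp add: mem_ball_Suc)

lemma ball_sym: "y \<in> hop_ball E x l \<Longrightarrow> x \<in> hop_ball E y l"
proof (induction l arbitrary: y)
  case (Suc l)
  consider "y \<in> hop_ball E x l" | u where "u \<in> hop_ball E x l" "{y, u} \<in> E"
    using Suc.prems by (auto simp: mem_ball_Suc insert_commute)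
  then show ?case
    using Suc.IH ball_mono_Suc ball_Cons by cases blast+
qed auto

text \<open>Balls are built by appending a last edge; walks in \<open>is_walk\<close> are built by
  prepending a first one. This peels off the first edge instead.\<close>

lemma ball_Suc_cases:
  "w \<in> hop_ball E v (Suc n) \<Longrightarrow> w \<in> hop_ball E v n \<or> (\<exists>y. {v, y} \<in> E \<and> w \<in> hop_ball E y n)"
proof (induction n arbitrary: w)
  case (Suc n)
  from Suc.prems consider "w \<in> hop_ball E v (Suc n)" | u where "u \<in> hop_ball E v (Suc n)" "{u, w} \<in> E"
    using mem_ball_Suc by blast
  then show ?case
  proof cases
    case 2
    then show ?thesis using Suc.IH[of u] ball_edge by blast
  qed auto
qed (auto simp: mem_ball_Suc)

text \<open>Whether a vertex lies within distance p + 1 depends only on edges meeting the ball of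
  radius p. The gain of one in the radius lets a switching use vertices of the outermost sphere
  without changing the ball.\<close>

lemma ball_cong:
  assumes "\<And>x y. x \<in> hop_ball E v p \<Longrightarrow> {x, y} \<in> E' \<longleftrightarrow> {x, y} \<in> E" "i \<le> Suc p"
  shows "hop_ball E' v i = hop_ball E v i"
  using assms(2)
proof (induction i)
  case (Suc i)
  have "hop_ball E v i \<subseteq> hop_ball E v p" using Suc.prems by (intro ball_mono) auto
  then have "{x, y} \<in> E' \<longleftrightarrow> {x, y} \<in> E" if "x \<in> hop_ball E v i" for x y
    using assms(1) that by auto
  then show ?case using Suc by (auto simp: mem_ball_Suc)
qed auto

lemma finite_all_edges: "finite (all_edges N)"
proof -
  have "all_edges N \<subseteq> Pow {..<N}" unfolding all_edges_def by auto
  then show ?thesis by (rule finite_subset) auto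
qed

lemma finite_regular_graphs: "finite (regular_graphs k N)"
proof -
  have "regular_graphs k N \<subseteq> Pow (all_edges N)" unfolding regular_graphs_def by auto
  then show ?thesis by (rule finite_subset) (simp add: finite_all_edges)
qed

lemma card_ordered_pairs:
  assumes "finite F" "\<And>e. e \<in> F \<Longrightarrow> \<exists>u v. e = {u, v} \<and> u \<noteq> v"
  shows "finite {(a, b). {a, b} \<in> F} \<and> card {(a, b). {a, b} \<in> F} = 2 * card F"
  using assms
proof (induction F)
  case (insert e F)
  obtain u v where e: "e = {u, v}" "u \<noteq> v" using insert.prems by blast
  have eq: "{(a, b). {a, b} \<in> insert e F} = insert (u, v) (insert (v, u) {(a, b). {a, b} \<in> F})"
    using e by (auto simp: doubleton_eq_iff)
  have IH: "finite {(a, b). {a, b} \<in> F}" "card {(a, b). {a, b} \<in> F} = 2 * card F"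
    using insert by auto
  have "(u, v) \<notin> {(a, b). {a, b} \<in> F}" "(v, u) \<notin> {(a, b). {a, b} \<in> F}"
    using insert.hyps e by (auto simp: insert_commute)
  then show ?case unfolding eq using IH insert.hyps e by auto
qed auto

section \<open>Counting edges and vertices in a fixed regular graph\<close>

locale regular_graph =
  fixes k N :: nat and E :: "nat set set"
  assumes reg: "E \<in> regular_graphs k N"
begin

lemma edge_D: "{u, y} \<in> E \<Longrightarrow> u < N \<and> y < N \<and> u \<noteq> y"
proof -
  assume "{u, y} \<in> E"
  then have "{u, y} \<in> all_edges N" using reg unfolding regular_graphs_def by blast
  then show ?thesis unfolding all_edges_def by (auto simp: doubleton_eq_iff)
qed

lemma edge_pair: "e \<in> E \<Longrightarrow> \<exists>u v. e = {u, v} \<and> u \<noteq> v"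
  using reg unfolding regular_graphs_def all_edges_def by blast

lemma finite_E: "finite E"
  using reg finite_all_edges finite_subset unfolding regular_graphs_def by blast

lemma finite_nbrs: "finite (nbrs E u)"
  by (rule finite_subset[of _ "{..<N}"]) (auto dest: edge_D)

lemma card_nbrs: "u < N \<Longrightarrow> card (nbrs E u) = k"
proof -
  assume u: "u < N"
  have "inj_on (\<lambda>y. {u, y}) (nbrs E u)" by (auto simp: inj_on_def doubleton_eq_iff)
  moreover have "(\<lambda>y. {u, y}) ` nbrs E u = {e \<in> E. u \<in> e}"
  proof (intro set_eqI iffI)
    fix e assume e: "e \<in> {e \<in> E. u \<in> e}"
    then obtain a b where "e = {a, b}" using edge_pair by blast
    then have "\<exists>y. e = {u, y}" using e by auto
    then show "e \<in> (\<lambda>y. {u, y}) ` nbrs E u" using e by auto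
  qed auto
  ultimately show ?thesis
    using reg u card_image unfolding regular_graphs_def by fastforce
qed

lemma card_nbrs_le: "card (nbrs E u) \<le> k"
proof (cases "u < N")
  case False
  then have "nbrs E u = {}" by (auto dest: edge_D)
  then show ?thesis by simp
qed (simp add: card_nbrs)

lemma ball_subset: "v < N \<Longrightarrow> hop_ball E v l \<subseteq> {..<N}"
  by (induction l) (auto simp: mem_ball_Suc dest: edge_D)

lemma finite_ball: "finite (hop_ball E v l)"
  by (induction l) (auto simp: hop_ball.simps finite_nbrs)

lemma finite_boundary: "finite (boundary E A)"
  by (rule finite_subset[of _ "{..<N} \<times> {..<N}"]) (auto simp: boundary_def dest: edge_D)

lemma finite_touch: "finite {e \<in> E. e \<inter> A \<noteq> {}}"
  using finite_E by simp

lemma degree_sum: "A \<subseteq> {..<N} \<Longrightarrow> card (Sigma A (nbrs E)) = k * card A"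
  using finite_subset[of A "{..<N}"] finite_nbrs
  by (subst card_SigmaI) (auto simp: card_nbrs subset_iff)

text \<open>Count orientations of the touched edges: those starting in A number k per vertex, and
  those starting outside A are reversed boundary pairs.\<close>

lemma handshake:
  assumes "A \<subseteq> {..<N}"
  shows "2 * touch E A = k * card A + card (boundary E A)"
proof -
  let ?F = "{e \<in> E. e \<inter> A \<noteq> {}}"
  have "2 * touch E A = card {(a, b). {a, b} \<in> ?F}"
    unfolding touch_def using card_ordered_pairs[of ?F] finite_E edge_pair by force
  also have "{(a, b). {a, b} \<in> ?F} = Sigma A (nbrs E) \<union> prod.swap ` boundary E A"
    by (auto simp: boundary_def image_iff insert_commute)
  also have "card \<dots> = card (Sigma A (nbrs E)) + card (prod.swap ` boundary E A)"
    using finite_subset[OF assms] finite_nbrs finite_boundary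
    by (intro card_Un_disjoint) (auto simp: boundary_def)
  also have "\<dots> = k * card A + card (boundary E A)"
    using degree_sum[OF assms] by (simp add: card_image)
  finally show ?thesis .
qed

lemma boundary_ball: "card (hop_ball E v (Suc l)) \<le> card (hop_ball E v l) + card (boundary E (hop_ball E v l))"
proof -
  have "hop_ball E v (Suc l) \<subseteq> hop_ball E v l \<union> snd ` boundary E (hop_ball E v l)"
    by (force simp: boundary_def image_iff mem_ball_Suc)
  then have "card (hop_ball E v (Suc l)) \<le> card (hop_ball E v l \<union> snd ` boundary E (hop_ball E v l))"
    using finite_ball finite_boundary by (intro card_mono) auto
  also have "\<dots> \<le> card (hop_ball E v l) + card (snd ` boundary E (hop_ball E v l))"
    by (rule card_Un_le)
  finally show ?thesis
    using card_image_le[OF finite_boundary, of snd "hop_ball E v l"] by linarith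
qed

lemma touch_single: "v < N \<Longrightarrow> touch E {v} = k"
  using reg unfolding regular_graphs_def touch_def by simp

lemma card_ball_1: "v < N \<Longrightarrow> card (hop_ball E v 1) = k + 1"
  using finite_nbrs[of v] card_nbrs[of v] edge_D[of v v] by (auto simp: card_insert_if hop_ball.simps)

text \<open>The sum telescopes from \<open>touch E {v} = k\<close> and a first ball of size k + 1.
  The right side is edges minus vertices plus one, the cycle rank of the connected graph formed by
  the edges touched by the ball of radius l.\<close>

lemma sum_newexc:
  assumes "v < N"
  shows "(\<Sum>p<l. newexc E v p) = int (touch E (hop_ball E v l)) - int (card (hop_ball E v (Suc l))) + 1"
proof (induction l)
  case 0
  then show ?case using touch_single card_ball_1 assms by simp
next
  case (Suc l)
  then show ?case by (simp add: newexc_def)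
qed

text \<open>Insert the edge count of \<open>sum_newexc\<close> into \<open>handshake\<close> and
  bound the boundary below by the number of new vertices. Each excess edge costs two vertices
  compared with the tree.\<close>

lemma ball_growth:
  assumes "v < N"
  shows "int (card (hop_ball E v (Suc l))) \<ge> (int k - 1) * int (card (hop_ball E v l)) - 2 * (\<Sum>p<l. newexc E v p)"
    and "int (card (boundary E (hop_ball E v l))) \<ge> (int k - 2) * int (card (hop_ball E v l)) - 2 * (\<Sum>p<l. newexc E v p)"
proof -
  have h: "2 * int (touch E (hop_ball E v l)) = int k * int (card (hop_ball E v l)) + int (card (boundary E (hop_ball E v l)))"
    using handshake[OF ball_subset[OF assms], of l]
    by (metis int_plus of_nat_mult of_nat_numeral)
  have b: "int (card (hop_ball E v (Suc l))) \<le> int (card (hop_ball E v l)) + int (card (boundary E (hop_ball E v l)))"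
    using boundary_ball[of v l] by linarith
  show "int (card (hop_ball E v (Suc l))) \<ge> (int k - 1) * int (card (hop_ball E v l)) - 2 * (\<Sum>p<l. newexc E v p)"
    using h b sum_newexc[OF assms, of l] by (simp add: algebra_simps)
  then show "int (card (boundary E (hop_ball E v l))) \<ge> (int k - 2) * int (card (hop_ball E v l)) - 2 * (\<Sum>p<l. newexc E v p)"
    using b by (simp add: algebra_simps)
qed

text \<open>A sphere vertex has at least one neighbour in the smaller ball, so at most k - 1 of its
  edges lead outward.\<close>

lemma card_sphere_le:
  assumes k: "k \<ge> 1"
  shows "card (hop_ball E v (Suc (Suc l)) - hop_ball E v (Suc l)) \<le> (k - 1) * card (hop_ball E v (Suc l) - hop_ball E v l)"
proof -
  let ?S = "hop_ball E v (Suc l) - hop_ball E v l"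
  have "hop_ball E v (Suc (Suc l)) - hop_ball E v (Suc l) \<subseteq> (\<Union>x\<in>?S. nbrs E x - hop_ball E v (Suc l))"
  proof
    fix y assume "y \<in> hop_ball E v (Suc (Suc l)) - hop_ball E v (Suc l)"
    then obtain u where "u \<in> hop_ball E v (Suc l)" "{u, y} \<in> E" "y \<notin> hop_ball E v (Suc l)"
      using mem_ball_Suc[of y E v "Suc l"] by blast
    then show "y \<in> (\<Union>x\<in>?S. nbrs E x - hop_ball E v (Suc l))"
      using ball_edge[of u E v l y] by auto
  qed
  then have "card (hop_ball E v (Suc (Suc l)) - hop_ball E v (Suc l)) \<le> card (\<Union>x\<in>?S. nbrs E x - hop_ball E v (Suc l))"
    using finite_ball finite_nbrs by (intro card_mono) auto
  also have "\<dots> \<le> (\<Sum>x\<in>?S. card (nbrs E x - hop_ball E v (Suc l)))"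
    using finite_ball by (intro card_UN_le) auto
  also have "\<dots> \<le> (\<Sum>x\<in>?S. k - 1)"
  proof (rule sum_mono)
    fix x assume x: "x \<in> ?S"
    then obtain y where y: "y \<in> hop_ball E v l" "{y, x} \<in> E" by (auto simp: mem_ball_Suc)
    have "nbrs E x - hop_ball E v (Suc l) \<subseteq> nbrs E x - {y}"
      using y ball_mono_Suc by auto
    then have "card (nbrs E x - hop_ball E v (Suc l)) \<le> card (nbrs E x - {y})"
      using finite_nbrs by (intro card_mono) auto
    also have "\<dots> = card (nbrs E x) - 1"
      using y by (intro card_Diff_singleton) (simp add: insert_commute)
    finally show "card (nbrs E x - hop_ball E v (Suc l)) \<le> k - 1"
      using card_nbrs_le[of x] by linarith
  qed
  finally show ?thesis by (simp add: mult.commute)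
qed

lemma card_ball_le:
  assumes k: "k \<ge> 3"
  shows "card (hop_ball E v l) \<le> 3 * (k - 1) ^ l"
proof -
  have s: "card (hop_ball E v (Suc l) - hop_ball E v l) \<le> k * (k - 1) ^ l" for l
  proof (induction l)
    case 0
    have "card (hop_ball E v (Suc 0) - hop_ball E v 0) \<le> card (nbrs E v)"
      using finite_nbrs by (intro card_mono) (auto simp: mem_ball_Suc)
    then show ?case using card_nbrs_le[of v] by simp
  next
    case (Suc l)
    have "(k - 1) * card (hop_ball E v (Suc l) - hop_ball E v l) \<le> (k - 1) * (k * (k - 1) ^ l)"
      using Suc by (rule mult_le_mono2)
    then show ?case using card_sphere_le[of v l] k
      by (simp add: mult.left_commute le_trans)
  qed
  define r where "r = k - 3"
  then have r: "k = r + 3" using k by simp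
  \<comment> \<open>The bound is an equality in the k-regular tree; keeping the summand 2 makes the
    induction close.\<close>
  have "(k - 2) * card (hop_ball E v l) + 2 \<le> k * (k - 1) ^ l"
  proof (induction l)
    case (Suc l)
    have "card (hop_ball E v (Suc l)) = card (hop_ball E v l) + card (hop_ball E v (Suc l) - hop_ball E v l)"
      using card_Diff_subset[OF finite_ball ball_mono_Suc, of v l] card_mono[OF finite_ball ball_mono_Suc, of v l]
      by simp
    also have "\<dots> \<le> card (hop_ball E v l) + k * (k - 1) ^ l" using s by simp
    finally have "(k - 2) * card (hop_ball E v (Suc l)) + 2 \<le> (k - 2) * (card (hop_ball E v l) + k * (k - 1) ^ l) + 2"
      by simp
    also have "\<dots> \<le> k * (k - 1) ^ l + (k - 2) * k * (k - 1) ^ l"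
      using Suc.IH by (simp add: algebra_simps)
    also have "\<dots> = k * (k - 1) ^ Suc l" using r by (simp add: algebra_simps)
    finally show ?case .
  qed (use k in auto)
  then have "(k - 2) * card (hop_ball E v l) \<le> k * (k - 1) ^ l" by linarith
  \<comment> \<open>For k at least 3, k is at most 3 (k - 2); this is the source of the constant
    3.\<close>
  also have "\<dots> \<le> (k - 2) * 3 * (k - 1) ^ l" using r by (intro mult_le_mono1) simp
  finally have "(k - 2) * card (hop_ball E v l) \<le> (k - 2) * (3 * (k - 1) ^ l)"
    by (simp only: mult.assoc)
  then show ?thesis using k by (subst (asm) mult_le_cancel1) auto
qed

end

section \<open>Vertex flow and far pairs\<close>

lemma walk_ball:
  "is_walk E xs \<Longrightarrow> length xs = Suc n \<Longrightarrow> last xs \<in> hop_ball E (hd xs) n"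
proof (induction E xs arbitrary: n rule: is_walk.induct)
  case (3 E x y xs)
  then obtain m where m: "n = Suc m" by (cases n) auto
  then have "last (y # xs) \<in> hop_ball E y m" using 3 by simp
  moreover have "{x, y} \<in> E" using 3 by simp
  ultimately have "last (y # xs) \<in> hop_ball E x (Suc m)" by (rule ball_Cons[rotated])
  then show ?case using m by simp
qed auto

lemma ball_walk:
  "w \<in> hop_ball E v n \<Longrightarrow> \<exists>xs. is_walk E xs \<and> hd xs = v \<and> last xs = w \<and> length xs \<le> Suc n"
proof (induction n arbitrary: v)
  case 0
  then have "is_walk E [v] \<and> hd [v] = v \<and> last [v] = w \<and> length [v] \<le> Suc 0" by simp
  then show ?case by blast
next
  case (Suc n)
  consider "w \<in> hop_ball E v n" | y where "{v, y} \<in> E" "w \<in> hop_ball E y n"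
    using ball_Suc_cases[OF Suc.prems] by blast
  then show ?case
  proof cases
    case 1
    then show ?thesis using Suc.IH le_SucI by blast
  next
    case 2
    then obtain xs where xs: "is_walk E xs" "hd xs = y" "last xs = w" "length xs \<le> Suc n"
      using Suc.IH by blast
    then obtain ys where "xs = y # ys" by (cases xs) auto
    then have "is_walk E (v # xs) \<and> hd (v # xs) = v \<and> last (v # xs) = w \<and> length (v # xs) \<le> Suc (Suc n)"
      using xs 2 by simp
    then show ?thesis by blast
  qed
qed

lemma hop_dist_le:
  assumes "w \<in> hop_ball E v n"
  shows "hop_dist E v w \<le> n"
proof -
  obtain xs where xs: "is_walk E xs" "hd xs = v" "last xs = w" "length xs \<le> Suc n"
    using ball_walk[OF assms] by blast
  then obtain m where m: "length xs = Suc m" by (cases xs) auto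
  then have "hop_dist E v w \<le> m"
    unfolding hop_dist_def using xs by (intro Least_le) blast
  then show ?thesis using m xs by simp
qed

lemma reach_ball: "reach E v w \<Longrightarrow> w \<in> hop_ball E v (hop_dist E v w)"
proof -
  assume "reach E v w"
  then obtain xs where xs: "is_walk E xs" "hd xs = v" "last xs = w" unfolding reach_def by blast
  then have "\<exists>n. \<exists>xs. is_walk E xs \<and> hd xs = v \<and> last xs = w \<and> length xs = Suc n"
    by (intro exI[of _ "length xs - 1"] exI[of _ xs]) (cases xs, auto)
  then have "\<exists>xs. is_walk E xs \<and> hd xs = v \<and> last xs = w \<and> length xs = Suc (hop_dist E v w)"
    unfolding hop_dist_def by (rule LeastI_ex)
  then show ?thesis using walk_ball by blast
qed

lemma reach_Cons: "\<lbrakk>{x, y} \<in> E; reach E y w\<rbrakk> \<Longrightarrow> reach E x w"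
proof -
  assume "{x, y} \<in> E" "reach E y w"
  moreover then obtain xs where "is_walk E xs" "hd xs = y" "last xs = w" unfolding reach_def by blast
  moreover then obtain ys where "xs = y # ys" by (cases xs) auto
  ultimately have "is_walk E (x # xs) \<and> hd (x # xs) = x \<and> last (x # xs) = w" by simp
  then show ?thesis unfolding reach_def by blast
qed

lemma step_flow_nonneg: "step_flow N E v w t x \<ge> 0"
  by (induction t arbitrary: x) (auto intro!: sum_nonneg)

text \<open>Every step moves along one edge and lowers the distance to w by exactly one, so both the
  time and the distance travelled are determined by x.\<close>

lemma step_flow_support:
  assumes "reach E v w" "step_flow N E v w t x \<noteq> 0"
  shows "v \<in> hop_ball E x t \<and> reach E x w \<and> hop_dist E x w + t = hop_dist E v w"
  using assms(2)
proof (induction t arbitrary: x)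
  case (Suc t)
  obtain y where "x \<in> next_hops N E w y" "step_flow N E v w t y \<noteq> 0"
  proof (rule ccontr)
    assume "\<not> thesis"
    then have "step_flow N E v w (Suc t) x = 0"
      using that by (simp del: not_gr0 div_by_0) (intro sum.neutral, auto)
    then show False using Suc.prems by simp
  qed
  moreover from this have "{x, y} \<in> E" by (simp add: next_hops_def insert_commute)
  ultimately show ?case
    using Suc.IH[of y] ball_Cons[of x y E v t] reach_Cons[of x y E w] by (auto simp: next_hops_def)
qed (use assms in \<open>auto split: if_splits\<close>)

text \<open>Equal splitting preserves mass wherever there is a next hop. At a vertex without one,
  such as w, the mass vanishes at the following step, hence only an inequality.\<close>

lemma sum_step_flow_le: "(\<Sum>x<N. step_flow N E v w t x) \<le> 1"
proof (induction t)
  case (Suc t)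
  have "(\<Sum>x<N. step_flow N E v w (Suc t) x)
      = (\<Sum>y<N. \<Sum>x<N. if x \<in> next_hops N E w y
              then step_flow N E v w t y / real (card (next_hops N E w y)) else 0)"
    by (simp only: step_flow.simps) (rule sum.swap)
  also have "\<dots> \<le> (\<Sum>y<N. step_flow N E v w t y)"
  proof (rule sum_mono)
    fix y
    have "next_hops N E w y \<subseteq> {..<N}" by (auto simp: next_hops_def)
    then have "(\<Sum>x<N. if x \<in> next_hops N E w y
              then step_flow N E v w t y / real (card (next_hops N E w y)) else 0)
          = (\<Sum>x\<in>next_hops N E w y. step_flow N E v w t y / real (card (next_hops N E w y)))"
      by (subst sum.inter_restrict[symmetric]) (auto simp: Int_absorb1)
    also have "\<dots> \<le> step_flow N E v w t y"
      using step_flow_nonneg by simp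
    finally show "(\<Sum>x<N. if x \<in> next_hops N E w y
              then step_flow N E v w t y / real (card (next_hops N E w y)) else 0) \<le> step_flow N E v w t y" .
  qed
  finally show ?case using Suc by linarith
qed simp

lemma step_flow_le_1: "x < N \<Longrightarrow> step_flow N E v w t x \<le> 1"
  using member_le_sum[of x "{..<N}" "step_flow N E v w t"] step_flow_nonneg sum_step_flow_le[of N E v w t]
  by fastforce

lemma pair_flow_le_1:
  assumes "x < N"
  shows "pair_flow N E v w x \<le> 1"
proof (cases "reach E v w")
  case True
  \<comment> \<open>By the support property this is the only time at which flow can sit at x, so the
    sum over times has at most one nonzero term.\<close>
  let ?t = "hop_dist E v w - hop_dist E x w"
  have "step_flow N E v w t x = (if t = ?t then step_flow N E v w t x else 0)" for t
    using step_flow_support[OF True, of N t x] by force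
  then have "(\<Sum>t\<le>hop_dist E v w. step_flow N E v w t x)
      = (\<Sum>t\<le>hop_dist E v w. if t = ?t then step_flow N E v w t x else 0)"
    by (intro sum.cong) auto
  also have "\<dots> \<le> 1" using step_flow_le_1[OF assms] by simp
  finally show ?thesis by (simp add: pair_flow_def)
qed (simp add: pair_flow_def)

lemma pair_flow_support:
  assumes "pair_flow N E v w x \<noteq> 0" "w \<in> hop_ball E v D"
  shows "(v, w) \<in> (\<Union>t\<le>D. hop_ball E x t \<times> hop_ball E x (D - t))"
proof -
  have re: "reach E v w" using assms by (auto simp: pair_flow_def split: if_splits)
  then have "(\<Sum>t\<le>hop_dist E v w. step_flow N E v w t x) \<noteq> 0"
    using assms by (simp add: pair_flow_def)
  then obtain t where t: "step_flow N E v w t x \<noteq> 0"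
    by (rule sum.not_neutral_contains_not_neutral)
  note s = step_flow_support[OF re t]
  have "hop_dist E v w \<le> D" by (rule hop_dist_le) fact
  with s have le: "hop_dist E x w \<le> D - t" "t \<le> D" by auto
  have "w \<in> hop_ball E x (hop_dist E x w)" using s reach_ball by blast
  then have "w \<in> hop_ball E x (D - t)" using ball_mono[OF le(1)] by blast
  then show ?thesis using s le by auto
qed

text \<open>Ordered by label, as in \<open>vertex_flow\<close>. Disconnected pairs count as
  far.\<close>

definition far_pairs :: "nat \<Rightarrow> nat \<Rightarrow> nat set set \<Rightarrow> (nat \<times> nat) set" where
  "far_pairs N D E = {(v, w). v < w \<and> w < N \<and> w \<notin> hop_ball E v D}"

lemma finite_far_pairs: "finite (far_pairs N D E)"
  by (rule finite_subset[of _ "{..<N} \<times> {..<N}"]) (auto simp: far_pairs_def)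

lemma (in regular_graph) vertex_flow_le:
  assumes k: "k \<ge> 3" and u: "u < N"
  shows "vertex_flow N E u \<le> real (card (far_pairs N D E)) + 9 * real (D + 1) * real (k - 1) ^ D"
proof -
  let ?P = "SIGMA w:{..<N}. {..<w}"
  let ?Q = "\<Union>t\<le>D. hop_ball E u t \<times> hop_ball E u (D - t)"
  have finQ: "finite ?Q" using finite_ball by auto
  have "vertex_flow N E u = (\<Sum>(w, v)\<in>?P. pair_flow N E v w u)"
    unfolding vertex_flow_def by (subst sum.Sigma) auto
  \<comment> \<open>A far pair is charged its trivial maximum 1; any other pair is charged only if
    its ends lie in balls around u of complementary radii t and D - t.\<close>
  also have "\<dots> \<le> (\<Sum>(w, v)\<in>?P. if (v, w) \<in> far_pairs N D E \<union> ?Q then 1 else 0)"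
  proof (rule sum_mono, clarify)
    fix w v assume "w < N" "v < w"
    then show "pair_flow N E v w u \<le> (if (v, w) \<in> far_pairs N D E \<union> ?Q then 1 else 0)"
      using pair_flow_le_1[OF u] pair_flow_support[of N E v w u D]
      by (cases "pair_flow N E v w u = 0") (auto simp: far_pairs_def)
  qed
  also have "\<dots> = real (card {p \<in> ?P. prod.swap p \<in> far_pairs N D E \<union> ?Q})"
    by (simp add: case_prod_beta' sum.If_cases Int_def prod.swap_def)
  also have "\<dots> \<le> real (card (far_pairs N D E \<union> ?Q))"
    using finQ finite_far_pairs
    by (intro of_nat_mono card_inj_on_le[of prod.swap]) auto
  also have "\<dots> \<le> real (card (far_pairs N D E)) + real (card ?Q)"
    using card_Un_le[of "far_pairs N D E" ?Q] by linarith
  also have "card ?Q \<le> (\<Sum>t\<le>D. card (hop_ball E u t \<times> hop_ball E u (D - t)))"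
    by (rule card_UN_le) simp
  also have "\<dots> \<le> (\<Sum>t\<le>D. 9 * (k - 1) ^ D)"
  proof (rule sum_mono)
    fix t assume "t \<in> {..D}"
    then have "(k - 1) ^ t * (k - 1) ^ (D - t) = (k - 1) ^ D" by (simp flip: power_add)
    then show "card (hop_ball E u t \<times> hop_ball E u (D - t)) \<le> 9 * (k - 1) ^ D"
      using mult_le_mono[OF card_ball_le[OF k, of u t] card_ball_le[OF k, of u "D - t"]]
      by (simp add: card_cartesian_product mult_ac)
  qed
  finally show ?thesis by (simp add: algebra_simps)
qed

section \<open>Switching away excess edges\<close>

definition switch :: "nat set set \<Rightarrow> nat \<Rightarrow> nat \<Rightarrow> nat \<Rightarrow> nat \<Rightarrow> nat set set" where
  "switch E x y z w = (E - {{x, y}, {z, w}}) \<union> {{x, z}, {y, w}}"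

text \<open>A switching is undone by the one with the two middle vertices exchanged, so the new
  graph together with the four vertices determines the old one.\<close>

lemma switch_switch:
  "\<lbrakk>{x, y} \<in> E; {z, w} \<in> E; {x, z} \<notin> E; {y, w} \<notin> E\<rbrakk> \<Longrightarrow> switch (switch E x y z w) x z y w = E"
  unfolding switch_def by blast

lemma switch_commute: "switch E x y z w = switch E z w x y"
  unfolding switch_def by (simp add: insert_commute)

text \<open>Label the edges of a bipartite graph between A and B by t. Since \<psi> recovers a from
  the image and its label, sending (a, t) to (\<phi> a t, t) injects the forward moves, at least f
  per element, into the backward ones, at most g per element.\<close>

lemma double_counting:
  fixes A B :: "'a set" and F G :: "'a \<Rightarrow> 't set"
  assumes fin: "finite A" "finite B" "\<And>a. a \<in> A \<Longrightarrow> finite (F a)" "\<And>b. b \<in> B \<Longrightarrow> finite (G b)"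
    and lower: "\<And>a. a \<in> A \<Longrightarrow> f \<le> card (F a)"
    and upper: "\<And>b. b \<in> B \<Longrightarrow> card (G b) \<le> g"
    and maps: "\<And>a t. \<lbrakk>a \<in> A; t \<in> F a\<rbrakk> \<Longrightarrow> \<phi> a t \<in> B \<and> t \<in> G (\<phi> a t) \<and> \<psi> (\<phi> a t) t = a"
  shows "card A * f \<le> card B * g"
proof -
  have "card A * f \<le> (\<Sum>a\<in>A. card (F a))"
    using sum_mono[of A "\<lambda>_. f" "\<lambda>a. card (F a)"] lower by simp
  also have "\<dots> = card (Sigma A F)" using fin by simp
  also have "\<dots> \<le> card (Sigma B G)"
  proof (rule card_inj_on_le[of "\<lambda>(a, t). (\<phi> a t, t)"])
    show "inj_on (\<lambda>(a, t). (\<phi> a t, t)) (Sigma A F)"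
      by (rule inj_on_inverseI[of _ "\<lambda>(b, t). (\<psi> b t, t)"]) (auto simp: maps)
    show "(\<lambda>(a, t). (\<phi> a t, t)) ` Sigma A F \<subseteq> Sigma B G" using maps by auto
    show "finite (Sigma B G)" using fin by auto
  qed
  also have "\<dots> = (\<Sum>b\<in>B. card (G b))" using fin by simp
  also have "\<dots> \<le> card B * g"
    using sum_mono[of B "\<lambda>b. card (G b)" "\<lambda>_. g"] upper by simp
  finally show ?thesis .
qed

lemma card_exchange: "\<lbrakk>finite D; a \<in> D; b \<notin> D\<rbrakk> \<Longrightarrow> card (insert b (D - {a})) = card D"
  by (metis Diff_iff card_Suc_Diff1 card_insert_disjoint finite_Diff)

context regular_graph
begin

text \<open>Each of the four vertices loses one old edge and gains one new edge; the hypotheses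
  exclude loops and double edges.\<close>

lemma switch_regular:
  assumes xy: "{x, y} \<in> E" and zw: "{z, w} \<in> E" and n: "{x, z} \<notin> E" "{y, w} \<notin> E" "x \<noteq> z" "y \<noteq> w"
  shows "switch E x y z w \<in> regular_graphs k N"
proof -
  let ?E' = "switch E x y z w"
  have lt: "x < N" "y < N" "z < N" "w < N" "x \<noteq> y" "z \<noteq> w" using xy zw edge_D by blast+
  \<comment> \<open>Were x = w or y = z, a new edge would coincide with \<open>{x, y}\<close>, which
    is already present.\<close>
  have ne: "x \<noteq> w" "y \<noteq> z" using xy zw n by (auto simp: insert_commute)
  have "{x, z} \<in> all_edges N" "{y, w} \<in> all_edges N"
    using lt n unfolding all_edges_def by blast+
  then have sub: "?E' \<subseteq> all_edges N"
    using reg unfolding regular_graphs_def switch_def by blast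
  have "card {e \<in> ?E'. u \<in> e} = k" if u: "u < N" for u
  proof -
    let ?D = "{e \<in> E. u \<in> e}"
    have D: "card ?D = k" "finite ?D" using reg u finite_E unfolding regular_graphs_def by auto
    have eq: "{e \<in> ?E'. u \<in> e} = {e \<in> {{x, z}, {y, w}}. u \<in> e} \<union> (?D - {{x, y}, {z, w}})"
      unfolding switch_def by blast
    consider "u = x" | "u = y" | "u = z" | "u = w" | "u \<notin> {x, y, z, w}" by blast
    then have "card {e \<in> ?E'. u \<in> e} = card ?D"
    proof cases
      case 1
      then have "{e \<in> {{x, z}, {y, w}}. u \<in> e} = {{x, z}}" "?D - {{x, y}, {z, w}} = ?D - {{x, y}}"
        using lt n ne by auto
      then have "{e \<in> ?E'. u \<in> e} = insert {x, z} (?D - {{x, y}})" unfolding eq by simp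
      then show ?thesis using 1 card_exchange[OF D(2), of "{x, y}" "{x, z}"] xy n by simp
    next
      case 2
      then have "{e \<in> {{x, z}, {y, w}}. u \<in> e} = {{y, w}}" "?D - {{x, y}, {z, w}} = ?D - {{x, y}}"
        using lt n ne by auto
      then have "{e \<in> ?E'. u \<in> e} = insert {y, w} (?D - {{x, y}})" unfolding eq by simp
      then show ?thesis using 2 card_exchange[OF D(2), of "{x, y}" "{y, w}"] xy n by simp
    next
      case 3
      then have "{e \<in> {{x, z}, {y, w}}. u \<in> e} = {{x, z}}" "?D - {{x, y}, {z, w}} = ?D - {{z, w}}"
        using lt n ne by auto
      then have "{e \<in> ?E'. u \<in> e} = insert {x, z} (?D - {{z, w}})" unfolding eq by simp
      then show ?thesis using 3 card_exchange[OF D(2), of "{z, w}" "{x, z}"] zw n by simp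
    next
      case 4
      then have "{e \<in> {{x, z}, {y, w}}. u \<in> e} = {{y, w}}" "?D - {{x, y}, {z, w}} = ?D - {{z, w}}"
        using lt n ne by auto
      then have "{e \<in> ?E'. u \<in> e} = insert {y, w} (?D - {{z, w}})" unfolding eq by simp
      then show ?thesis using 4 card_exchange[OF D(2), of "{z, w}" "{y, w}"] zw n by simp
    next
      case 5
      then have "{e \<in> ?E'. u \<in> e} = ?D" unfolding switch_def by (auto simp: doubleton_eq_iff)
      then show ?thesis by simp
    qed
    then show ?thesis using D by simp
  qed
  with sub show ?thesis unfolding regular_graphs_def by blast
qed

end

text \<open>Newly touched edges that close a cycle: either inside the sphere of radius p + 1, or
  leading to an outer vertex y with a second parent. In both cases y stays within distance p + 2
  once the edge is switched away.\<close>

definition excess_edges :: "nat set set \<Rightarrow> nat \<Rightarrow> nat \<Rightarrow> (nat \<times> nat) set" where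
  "excess_edges E v p = {(x, y). {x, y} \<in> E \<and> x \<in> hop_ball E v (Suc p) \<and> x \<notin> hop_ball E v p \<and> y \<notin> hop_ball E v p
     \<and> (y \<in> hop_ball E v (Suc p) \<or> (\<exists>x'\<in>hop_ball E v (Suc p). x' \<noteq> x \<and> {x', y} \<in> E))}"

text \<open>The partners for switching an excess edge (x, y). That \<open>{x, z}\<close> is a
  non-edge follows from z lying outside the ball of radius p + 2; for \<open>{y, w}\<close> it must
  be required.\<close>

definition far_edges :: "nat set set \<Rightarrow> nat \<Rightarrow> nat \<Rightarrow> nat \<Rightarrow> (nat \<times> nat) set" where
  "far_edges E v p y = {(z, w). {z, w} \<in> E \<and> z \<notin> hop_ball E v (Suc (Suc p)) \<and> w \<notin> hop_ball E v (Suc (Suc p))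
     \<and> {y, w} \<notin> E}"

lemma switch_edge_iff:
  "\<lbrakk>u \<noteq> x; u \<noteq> y; u \<noteq> z; u \<noteq> w\<rbrakk> \<Longrightarrow> {u, t} \<in> switch E x y z w \<longleftrightarrow> {u, t} \<in> E"
  by (auto simp: switch_def doubleton_eq_iff)

context regular_graph
begin

lemma finite_excess_edges: "finite (excess_edges E v p)"
  by (rule finite_subset[of _ "{..<N} \<times> {..<N}"]) (auto simp: excess_edges_def dest: edge_D)

lemma finite_far_edges: "finite (far_edges E v p y)"
  by (rule finite_subset[of _ "{..<N} \<times> {..<N}"]) (auto simp: far_edges_def dest: edge_D)

text \<open>Picking one parent edge for every vertex of the new sphere leaves exactly
  \<^term>\<open>newexc E v p\<close> of the newly touched edges, and each of these can be oriented as an excess edge.\<close>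

lemma newexc_le_excess_edges: "newexc E v p \<le> int (card (excess_edges E v p))"
proof -
  let ?R = "hop_ball E v p" and ?A = "hop_ball E v (Suc p)" and ?B = "hop_ball E v (Suc (Suc p))"
  let ?T = "{e \<in> E. e \<inter> ?A \<noteq> {} \<and> e \<inter> ?R = {}}"
  have RA: "?R \<subseteq> ?A" and AB: "?A \<subseteq> ?B" by (rule ball_mono_Suc)+
  have "\<forall>y\<in>?B - ?A. \<exists>x\<in>?A. {x, y} \<in> E" using mem_ball_Suc by blast
  then obtain par where par: "\<And>y. y \<in> ?B - ?A \<Longrightarrow> par y \<in> ?A \<and> {par y, y} \<in> E" by metis
  let ?P = "(\<lambda>y. {par y, y}) ` (?B - ?A)"
  have P_T: "?P \<subseteq> ?T"
  proof (rule image_subsetI)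
    fix y assume y: "y \<in> ?B - ?A"
    then have p: "par y \<in> ?A" "{par y, y} \<in> E" using par by auto
    moreover from this have "par y \<notin> ?R" using ball_edge y by blast
    ultimately show "{par y, y} \<in> ?T" using y RA by blast
  qed
  have inj: "inj_on (\<lambda>y. {par y, y}) (?B - ?A)"
  proof (rule inj_onI)
    fix y y' assume y: "y \<in> ?B - ?A" "y' \<in> ?B - ?A" and eq: "{par y, y} = {par y', y'}"
    have "par y' \<in> ?A" using par[OF y(2)] by simp
    then have "y \<noteq> par y'" using y by auto
    then show "y = y'" using eq by (simp add: doubleton_eq_iff)
  qed
  have sub: "?T - ?P \<subseteq> (\<lambda>(x, y). {x, y}) ` excess_edges E v p"
  proof
    fix e assume e: "e \<in> ?T - ?P"
    then have "e \<in> E" by simp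
    from edge_pair[OF this] obtain a b where ab: "e = {a, b}" by auto
    have "\<exists>x y. e = {x, y} \<and> x \<in> ?A"
    proof (cases "a \<in> ?A")
      case False
      then have "e = {b, a} \<and> b \<in> ?A" using e ab by auto
      then show ?thesis by blast
    qed (use ab in auto)
    then obtain x y where xy: "e = {x, y}" "x \<in> ?A" by blast
    have R: "x \<notin> ?R" "y \<notin> ?R" "{x, y} \<in> E" using e xy by auto
    have "y \<in> ?A \<or> (\<exists>x'\<in>?A. x' \<noteq> x \<and> {x', y} \<in> E)"
    proof (cases "y \<in> ?A")
      case False
      then have y: "y \<in> ?B - ?A" using R xy ball_edge by auto
      then have "par y \<noteq> x" using e xy by auto
      then show ?thesis using par[OF y] by blast
    qed auto
    then have "(x, y) \<in> excess_edges E v p" using R xy unfolding excess_edges_def by blast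
    then show "e \<in> (\<lambda>(x, y). {x, y}) ` excess_edges E v p" using xy by force
  qed
  have finT: "finite ?T" using finite_E by simp
  have "{e \<in> E. e \<inter> ?A \<noteq> {}} = {e \<in> E. e \<inter> ?R \<noteq> {}} \<union> ?T" using RA by blast
  then have "touch E ?A = touch E ?R + card ?T"
    unfolding touch_def using finite_E finT by (simp add: card_Un_disjoint disjoint_iff)
  moreover have "card ?T = card ?P + card (?T - ?P)"
    using card_Diff_subset[OF finite_subset[OF P_T finT] P_T] card_mono[OF finT P_T] by linarith
  moreover have "card ?P = card ?B - card ?A" "card ?A \<le> card ?B"
    unfolding card_image[OF inj] using card_Diff_subset[OF finite_ball AB] card_mono[OF finite_ball AB] by auto
  moreover have "card (?T - ?P) \<le> card (excess_edges E v p)"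
    using card_mono[OF finite_imageI[OF finite_excess_edges] sub]
      card_image_le[OF finite_excess_edges, of "\<lambda>(x, y). {x, y}" v p] by linarith
  ultimately show ?thesis unfolding newexc_def by linarith
qed

text \<open>Of the k N oriented edges, at most 2 k per ball vertex have an end in the ball, and at
  most k * k end at a neighbour of y.\<close>

lemma card_far_edges:
  "k * N \<le> card (far_edges E v p y) + 2 * k * card (hop_ball E v (Suc (Suc p))) + k * k"
proof -
  let ?B = "hop_ball E v (Suc (Suc p))"
  let ?all = "Sigma {..<N} (nbrs E)" and ?Z = "Sigma ?B (nbrs E)" and ?Y = "Sigma (nbrs E y) (nbrs E)"
  have finS: "finite (Sigma S (nbrs E))" if "finite S" for S using that finite_nbrs by auto
  have cardS: "card (Sigma S (nbrs E)) \<le> k * card S" if "finite S" for S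
    using sum_mono[of S "\<lambda>x. card (nbrs E x)" "\<lambda>_. k"] that finite_nbrs card_nbrs_le
    by (subst card_SigmaI) (auto simp: mult.commute)
  have "?all \<subseteq> far_edges E v p y \<union> ?Z \<union> prod.swap ` ?Z \<union> prod.swap ` ?Y"
    by (auto simp: far_edges_def image_iff insert_commute)
  then have "card ?all \<le> card (far_edges E v p y \<union> ?Z \<union> prod.swap ` ?Z \<union> prod.swap ` ?Y)"
    using finite_far_edges finS finite_ball finite_nbrs by (intro card_mono) auto
  also have "\<dots> \<le> card (far_edges E v p y) + card ?Z + card (prod.swap ` ?Z) + card (prod.swap ` ?Y)"
    by (meson add_le_mono1 card_Un_le le_trans)
  also have "\<dots> \<le> card (far_edges E v p y) + k * card ?B + k * card ?B + k * k"
    using cardS[OF finite_ball[of v "Suc (Suc p)"]] cardS[OF finite_nbrs[of y]]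
      mult_le_mono2[OF card_nbrs_le[of y], of k] card_image_le[OF finS[OF finite_ball[of v "Suc (Suc p)"]], of prod.swap]
      card_image_le[OF finS[OF finite_nbrs[of y]], of prod.swap]
    by linarith
  finally show ?thesis using degree_sum[of "{..<N}"] by simp
qed

text \<open>The switching leaves the ball of radius p and the edges at it untouched, lowers the
  excess by at most one, and keeps x and y within distance p + 2. The last fact limits the reverse
  switchings to pairs of ball vertices.\<close>

lemma excess_switch:
  assumes xy: "(x, y) \<in> excess_edges E v p" and zw: "(z, w) \<in> far_edges E v p y"
  defines "E' \<equiv> switch E x y z w"
  shows "E' \<in> regular_graphs k N" "newexc E v p - 1 \<le> newexc E' v p"
    "x \<in> hop_ball E' v (Suc (Suc p))" "y \<in> hop_ball E' v (Suc (Suc p))" "{x, z} \<in> E'" "{y, w} \<in> E'"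
    "switch E' x z y w = E"
proof -
  let ?R = "hop_ball E v p" and ?A = "hop_ball E v (Suc p)" and ?B = "hop_ball E v (Suc (Suc p))"
  have RA: "?R \<subseteq> ?A" and AB: "?A \<subseteq> ?B" by (rule ball_mono_Suc)+
  have x: "{x, y} \<in> E" "x \<in> ?A" "x \<notin> ?R" "y \<notin> ?R" using xy unfolding excess_edges_def by auto
  have y: "y \<in> ?A \<or> (\<exists>x'\<in>?A. x' \<noteq> x \<and> {x', y} \<in> E)" using xy unfolding excess_edges_def by auto
  have yB: "y \<in> ?B" using x ball_edge by blast
  have z: "{z, w} \<in> E" "z \<notin> ?B" "w \<notin> ?B" "{y, w} \<notin> E" using zw unfolding far_edges_def by auto
  have xz: "{x, z} \<notin> E" using x z ball_edge by blast
  have ne: "x \<noteq> z" "y \<noteq> w" "x \<noteq> w" "y \<noteq> z" "x \<noteq> y" "z \<noteq> w" using x z yB AB edge_D by blast+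
  show reg': "E' \<in> regular_graphs k N"
    unfolding E'_def using x z xz ne by (intro switch_regular) auto
  then interpret E': regular_graph k N E' by unfold_locales
  show "{x, z} \<in> E'" "{y, w} \<in> E'" unfolding E'_def switch_def by auto
  show "switch E' x z y w = E" unfolding E'_def using x z xz by (intro switch_switch) auto
  have notR: "u \<noteq> x \<and> u \<noteq> y \<and> u \<noteq> z \<and> u \<noteq> w" if "u \<in> ?R" for u
    using that x z RA AB by blast
  have cong: "{u, t} \<in> E' \<longleftrightarrow> {u, t} \<in> E" if "u \<in> ?R" for u t
    unfolding E'_def using notR[OF that] by (intro switch_edge_iff) auto
  have balls: "hop_ball E' v (Suc p) = ?A" "hop_ball E' v p = ?R"
    using ball_cong[of E v p E'] cong by auto
  show "x \<in> hop_ball E' v (Suc (Suc p))" using balls x ball_mono_Suc by blast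
  \<comment> \<open>The second parent of y survives the switching.\<close>
  have "\<exists>x'\<in>?A. {x', y} \<in> E'" if "y \<notin> ?A"
  proof -
    obtain x' where x': "x' \<in> ?A" "x' \<noteq> x" "{x', y} \<in> E" using y \<open>y \<notin> ?A\<close> by blast
    then have "{x', y} \<in> E'" unfolding E'_def switch_def using yB z by (auto simp: doubleton_eq_iff)
    then show ?thesis using x' by blast
  qed
  then show "y \<in> hop_ball E' v (Suc (Suc p))"
    using balls by (auto simp: mem_ball_Suc[of _ _ _ "Suc p"])
  have touchR: "touch E' ?R = touch E ?R"
  proof -
    have "{e \<in> E'. e \<inter> ?R \<noteq> {}} = {e \<in> E. e \<inter> ?R \<noteq> {}}"
      unfolding E'_def switch_def using notR by blast
    then show ?thesis unfolding touch_def by simp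
  qed
  let ?T = "{e \<in> E. e \<inter> ?A \<noteq> {}}" and ?T' = "{e \<in> E'. e \<inter> ?A \<noteq> {}}"
  have zwA: "z \<notin> ?A" "w \<notin> ?A" using z AB by auto
  have cT: "card (insert {x, z} (?T - {{x, y}})) = card ?T"
    using finite_touch[of ?A] x xz by (intro card_exchange) auto
  have B': "u = z \<and> y \<notin> ?A \<or> u \<in> {z, w} \<and> y \<in> ?A \<or> u \<in> ?B" if "u \<in> hop_ball E' v (Suc (Suc p))" for u
  proof -
    from that consider "u \<in> ?A" | a where "a \<in> ?A" "{a, u} \<in> E'"
      using balls mem_ball_Suc by blast
    then show ?thesis
    proof cases
      case 2
      then consider "{a, u} \<in> E" | "{a, u} = {x, z}" | "{a, u} = {y, w}"
        unfolding E'_def switch_def by blast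
      then show ?thesis using 2 zwA ball_edge by cases (auto simp: doubleton_eq_iff)
    qed (use AB in auto)
  qed
  \<comment> \<open>If y is in \<open>?A\<close>, one touched edge becomes two while at most z and w
    join the larger ball. Otherwise the touched edges do not decrease in number and only z can join.
    Either way the difference drops by at most one.\<close>
  have ge: "int (touch E' ?A) - int (card (hop_ball E' v (Suc (Suc p)))) \<ge> int (touch E ?A) - int (card ?B) - 1"
  proof (cases "y \<in> ?A")
    case True
    have "insert {y, w} (insert {x, z} (?T - {{x, y}})) \<subseteq> ?T'"
      unfolding E'_def switch_def using x z zwA True by blast
    then have "card (insert {y, w} (insert {x, z} (?T - {{x, y}}))) \<le> card ?T'"
      using E'.finite_touch by (intro card_mono)
    moreover have "{y, w} \<notin> insert {x, z} (?T - {{x, y}})"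
      using z ne by (auto simp: doubleton_eq_iff)
    ultimately have "touch E ?A + 1 \<le> touch E' ?A"
      unfolding touch_def using cT finite_touch[of ?A] by simp
    moreover have "card (hop_ball E' v (Suc (Suc p))) \<le> card (insert z (insert w ?B))"
      using B' True finite_ball by (intro card_mono) auto
    then have "card (hop_ball E' v (Suc (Suc p))) \<le> card ?B + 2"
      using finite_ball[of v "Suc (Suc p)"] by (auto simp: card_insert_if split: if_splits)
    ultimately show ?thesis by linarith
  next
    case False
    have "insert {x, z} (?T - {{x, y}}) \<subseteq> ?T'"
      unfolding E'_def switch_def using x z zwA by blast
    then have "card (insert {x, z} (?T - {{x, y}})) \<le> card ?T'"
      using E'.finite_touch by (intro card_mono)
    then have "touch E ?A \<le> touch E' ?A"
      unfolding touch_def using cT by simp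
    moreover have "card (hop_ball E' v (Suc (Suc p))) \<le> card (insert z ?B)"
      using B' False finite_ball by (intro card_mono) auto
    then have "card (hop_ball E' v (Suc (Suc p))) \<le> card ?B + 1"
      using finite_ball[of v "Suc (Suc p)"] by (auto simp: card_insert_if split: if_splits)
    ultimately show ?thesis by linarith
  qed
  show "newexc E v p - 1 \<le> newexc E' v p"
    unfolding newexc_def balls touchR using ge by linarith
qed

end

text \<open>A threshold rather than an exact value, because a switching is only known to lower
  \<open>newexc\<close> by at most one.\<close>

definition excess_class :: "nat \<Rightarrow> nat \<Rightarrow> nat \<Rightarrow> nat \<Rightarrow> nat \<Rightarrow> nat set set set" where
  "excess_class k N v p j = {E \<in> regular_graphs k N. int j \<le> newexc E v p}"

text \<open>Forward there are at least j + 1 excess edges with at least N partners each, which is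
  what \<open>large\<close> secures. Backward one picks two vertices of the ball of radius p + 2 and
  a neighbour of each.\<close>

lemma excess_class_step:
  assumes k: "k \<ge> 3" and v: "v < N"
    and large: "N + 2 * k * (3 * (k - 1) ^ (p + 2)) + k * k \<le> k * N"
  shows "card (excess_class k N v p (Suc j)) * (Suc j * N)
       \<le> card (excess_class k N v p j) * (3 * (k - 1) ^ (p + 2) * k)\<^sup>2"
proof -
  let ?F = "\<lambda>E. SIGMA e:excess_edges E v p. far_edges E v p (snd e)"
  let ?B = "\<lambda>E. hop_ball E v (Suc (Suc p))"
  let ?G = "\<lambda>E. SIGMA e:?B E \<times> ?B E. nbrs E (fst e) \<times> nbrs E (snd e)"
  let ?\<phi> = "\<lambda>E (e, f). switch E (fst e) (snd e) (fst f) (snd f)"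
  let ?\<psi> = "\<lambda>E (e, f). switch E (fst e) (fst f) (snd e) (snd f)"
  have fin: "finite (excess_class k N v p i)" for i
    unfolding excess_class_def using finite_regular_graphs by auto
  have lower: "finite (?F E) \<and> Suc j * N \<le> card (?F E)"
    and maps: "t \<in> ?F E \<longrightarrow> ?\<phi> E t \<in> excess_class k N v p j \<and> t \<in> ?G (?\<phi> E t) \<and> ?\<psi> (?\<phi> E t) t = E"
    if E: "E \<in> excess_class k N v p (Suc j)" for E t
  proof -
    interpret regular_graph k N E using E by unfold_locales (simp add: excess_class_def)
    have far: "N \<le> card (far_edges E v p y)" for y
    proof -
      have "2 * k * card (?B E) \<le> 2 * k * (3 * (k - 1) ^ (p + 2))"
        using card_ball_le[OF k, of v "Suc (Suc p)"] by (intro mult_le_mono2) simp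
      then show ?thesis using card_far_edges[of v p y] large by linarith
    qed
    have "Suc j \<le> card (excess_edges E v p)"
      using newexc_le_excess_edges[of v p] E by (auto simp: excess_class_def)
    then have "Suc j * N \<le> card (excess_edges E v p) * N" by (rule mult_le_mono1)
    also have "\<dots> \<le> (\<Sum>e\<in>excess_edges E v p. card (far_edges E v p (snd e)))"
      using sum_mono[of "excess_edges E v p" "\<lambda>_. N" "\<lambda>e. card (far_edges E v p (snd e))"] far by auto
    finally show "finite (?F E) \<and> Suc j * N \<le> card (?F E)"
      using finite_excess_edges finite_far_edges by simp
    show "t \<in> ?F E \<longrightarrow> ?\<phi> E t \<in> excess_class k N v p j \<and> t \<in> ?G (?\<phi> E t) \<and> ?\<psi> (?\<phi> E t) t = E"
    proof
      assume "t \<in> ?F E"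
      then obtain x y z w where t: "t = ((x, y), (z, w))"
          and xy: "(x, y) \<in> excess_edges E v p" and zw: "(z, w) \<in> far_edges E v p y" by auto
      show "?\<phi> E t \<in> excess_class k N v p j \<and> t \<in> ?G (?\<phi> E t) \<and> ?\<psi> (?\<phi> E t) t = E"
        using excess_switch[OF xy zw] E by (simp add: t excess_class_def)
    qed
  qed
  have upper: "finite (?G E) \<and> card (?G E) \<le> (3 * (k - 1) ^ (p + 2) * k)\<^sup>2"
    if E: "E \<in> excess_class k N v p j" for E
  proof -
    interpret regular_graph k N E using E by unfold_locales (simp add: excess_class_def)
    have "card (?G E) = (\<Sum>e\<in>?B E \<times> ?B E. card (nbrs E (fst e)) * card (nbrs E (snd e)))"
      using finite_ball finite_nbrs by (subst card_SigmaI) (auto simp: card_cartesian_product)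
    also have "\<dots> \<le> (\<Sum>e\<in>?B E \<times> ?B E. k * k)"
      by (intro sum_mono mult_le_mono card_nbrs_le)
    also have "\<dots> = (card (?B E) * k)\<^sup>2"
      by (simp add: card_cartesian_product power2_eq_square)
    also have "\<dots> \<le> (3 * (k - 1) ^ (p + 2) * k)\<^sup>2"
      using card_ball_le[OF k, of v "Suc (Suc p)"] by (intro power_mono mult_le_mono1) simp_all
    finally show ?thesis using finite_ball finite_nbrs by auto
  qed
  show ?thesis
    by (rule double_counting[where F = ?F and G = ?G and \<phi> = ?\<phi> and \<psi> = ?\<psi>])
      (use fin lower upper maps in blast)+
qed

section \<open>Switching to connect two balls\<close>

definition cross_edges :: "nat set set \<Rightarrow> nat set \<Rightarrow> nat set \<Rightarrow> (nat \<times> nat) set" where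
  "cross_edges E A B = {(a, b). a \<in> A \<and> b \<in> B \<and> {a, b} \<in> E}"

text \<open>Pairs of edges leaving A and B whose switching is legal and adds exactly one edge
  between disjoint A and B: a' avoids B and b' avoids A, so no cross edge is used up.\<close>

definition open_pairs :: "nat set set \<Rightarrow> nat set \<Rightarrow> nat set \<Rightarrow> ((nat \<times> nat) \<times> (nat \<times> nat)) set" where
  "open_pairs E A B = {((a, a'), (b, b')). (a, a') \<in> boundary E A \<and> a' \<notin> B \<and> (b, b') \<in> boundary E B \<and> b' \<notin> A
     \<and> a' \<noteq> b' \<and> {a', b'} \<notin> E \<and> {a, b} \<notin> E}"

lemma boundary_switch:
  assumes "(a, a') \<in> boundary E A" "b \<notin> A" "b' \<notin> A"
  shows "boundary (switch E a a' b b') A = insert (a, b) (boundary E A - {(a, a')})"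
  using assms unfolding boundary_def switch_def by (auto simp: doubleton_eq_iff)

lemma cross_edges_switch:
  assumes "A \<inter> B = {}" "a \<in> A" "b \<in> B" "a' \<notin> A" "a' \<notin> B" "b' \<notin> A" "b' \<notin> B"
  shows "cross_edges (switch E a a' b b') A B = insert (a, b) (cross_edges E A B)"
  using assms unfolding cross_edges_def switch_def by (auto simp: doubleton_eq_iff)

lemma ball_switch:
  assumes "{x, y, z, w} \<inter> hop_ball E v p = {}"
  shows "hop_ball (switch E x y z w) v (Suc p) = hop_ball E v (Suc p)"
proof (rule ball_cong[of E v p])
  fix u t assume "u \<in> hop_ball E v p"
  with assms show "{u, t} \<in> switch E x y z w \<longleftrightarrow> {u, t} \<in> E" by (intro switch_edge_iff) auto
qed auto

context regular_graph
begin

lemma finite_cross_edges: "finite (cross_edges E A B)"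
  by (rule finite_subset[of _ "{..<N} \<times> {..<N}"]) (auto simp: cross_edges_def dest: edge_D)

lemma finite_open_pairs: "finite (open_pairs E A B)"
  by (rule finite_subset[of _ "boundary E A \<times> boundary E B"]) (auto simp: open_pairs_def finite_boundary)

lemma card_paths_le: "finite (Sigma (nbrs E y) (nbrs E)) \<and> card (Sigma (nbrs E y) (nbrs E)) \<le> k * k"
proof -
  have "(\<Sum>x\<in>nbrs E y. card (nbrs E x)) \<le> (\<Sum>x\<in>nbrs E y. k)"
    by (intro sum_mono card_nbrs_le)
  also have "\<dots> \<le> k * k" using card_nbrs_le by simp
  finally show ?thesis using finite_nbrs by simp
qed

lemma card_boundary_cross:
  "card (boundary E A) \<le> card {(a, a') \<in> boundary E A. a' \<notin> B} + card (cross_edges E A B)"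
proof -
  have "boundary E A \<subseteq> {(a, a') \<in> boundary E A. a' \<notin> B} \<union> cross_edges E A B"
    by (auto simp: boundary_def cross_edges_def)
  then have "card (boundary E A) \<le> card ({(a, a') \<in> boundary E A. a' \<notin> B} \<union> cross_edges E A B)"
    using finite_boundary[of A] finite_cross_edges by (intro card_mono) (auto intro: finite_subset)
  then show ?thesis using card_Un_le le_trans by blast
qed

lemma card_cross_commute: "card (cross_edges E B A) = card (cross_edges E A B)"
proof -
  have "cross_edges E B A = prod.swap ` cross_edges E A B"
    by (auto simp: cross_edges_def image_iff insert_commute)
  then show ?thesis by (simp add: card_image)
qed

text \<open>Discarding cross edges leaves at least s + 3 k k boundary edges on each side; after one
  is chosen in A, at most 3 k k choices in B are illegal.\<close>

lemma card_open_pairs: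
  assumes "s + m + 3 * k * k \<le> card (boundary E A)" "s + m + 3 * k * k \<le> card (boundary E B)"
    and m: "card (cross_edges E A B) \<le> m"
  shows "s * s \<le> card (open_pairs E A B)"
proof -
  let ?P = "{(a, a') \<in> boundary E A. a' \<notin> B}" and ?Q = "{(b, b') \<in> boundary E B. b' \<notin> A}"
  \<comment> \<open>For p = (a, a') the three sets contain the (b, b') with b' = a', with b'
    adjacent to a', and with b adjacent to a. Each has at most k * k elements.\<close>
  define bad where "bad p = prod.swap ` ({snd p} \<times> nbrs E (snd p)) \<union> prod.swap ` Sigma (nbrs E (snd p)) (nbrs E)
    \<union> Sigma (nbrs E (fst p)) (nbrs E)" for p
  have finP: "finite ?P" and finQ: "finite ?Q"
    using finite_boundary by (auto intro: finite_subset[OF _ finite_boundary])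
  have P: "s \<le> card ?P" and Q: "s + 3 * k * k \<le> card ?Q"
    using card_boundary_cross[of A B] card_boundary_cross[of B A] card_cross_commute[of B A] assms
    by linarith+
  have bad: "finite (bad p)" "card (bad p) \<le> 3 * k * k" for p
  proof -
    have 1: "finite (prod.swap ` ({snd p} \<times> nbrs E (snd p)))" "card (prod.swap ` ({snd p} \<times> nbrs E (snd p))) \<le> k * k"
    proof -
      have "card (prod.swap ` ({snd p} \<times> nbrs E (snd p))) \<le> card ({snd p} \<times> nbrs E (snd p))"
        using finite_nbrs by (intro card_image_le) auto
      also have "\<dots> \<le> k" using card_nbrs_le by (simp add: card_cartesian_product)
      finally show "card (prod.swap ` ({snd p} \<times> nbrs E (snd p))) \<le> k * k"
        by (metis le_square le_trans)
    qed (use finite_nbrs in auto)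
    have 2: "finite (prod.swap ` Sigma (nbrs E (snd p)) (nbrs E))" "card (prod.swap ` Sigma (nbrs E (snd p)) (nbrs E)) \<le> k * k"
      using card_paths_le[of "snd p"] card_image_le le_trans by blast+
    show "finite (bad p)" unfolding bad_def using 1 2 card_paths_le by blast
    have "card (bad p) \<le> k * k + k * k + k * k"
      unfolding bad_def using 1 2 card_paths_le[of "fst p"]
      by (meson add_mono card_Un_le le_trans)
    then show "card (bad p) \<le> 3 * k * k" by simp
  qed
  have sub: "Sigma ?P (\<lambda>p. ?Q - bad p) \<subseteq> open_pairs E A B"
    by (auto simp: open_pairs_def bad_def boundary_def image_iff insert_commute)
  have "s * s \<le> card ?P * s" using P by (rule mult_le_mono1)
  also have "\<dots> \<le> (\<Sum>p\<in>?P. card (?Q - bad p))"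
  proof -
    have "s \<le> card (?Q - bad p)" for p
      using bad[of p] Q diff_card_le_card_Diff[of "bad p" ?Q] by linarith
    then show ?thesis using sum_mono[of ?P "\<lambda>_. s" "\<lambda>p. card (?Q - bad p)"] by simp
  qed
  also have "\<dots> = card (Sigma ?P (\<lambda>p. ?Q - bad p))"
    using finP finQ by (simp add: card_SigmaI)
  also have "\<dots> \<le> card (open_pairs E A B)"
    using sub finite_open_pairs by (intro card_mono)
  finally show ?thesis .
qed

text \<open>The inner ends a and b lie on the outermost spheres, so the edges at the balls of radius
  p, and hence the balls of radius p + 1, are unaffected. Each boundary merely exchanges one pair
  for another.\<close>

lemma open_switch:
  assumes disj: "hop_ball E v (Suc p) \<inter> hop_ball E w (Suc p) = {}"
    and op: "((a, a'), (b, b')) \<in> open_pairs E (hop_ball E v (Suc p)) (hop_ball E w (Suc p))"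
  defines "E' \<equiv> switch E a a' b b'"
  shows "E' \<in> regular_graphs k N"
    "hop_ball E' v (Suc p) = hop_ball E v (Suc p)" "hop_ball E' w (Suc p) = hop_ball E w (Suc p)"
    "card (boundary E' (hop_ball E v (Suc p))) = card (boundary E (hop_ball E v (Suc p)))"
    "card (boundary E' (hop_ball E w (Suc p))) = card (boundary E (hop_ball E w (Suc p)))"
    "card (cross_edges E' (hop_ball E v (Suc p)) (hop_ball E w (Suc p)))
       = Suc (card (cross_edges E (hop_ball E v (Suc p)) (hop_ball E w (Suc p))))"
    "(a, b) \<in> cross_edges E' (hop_ball E v (Suc p)) (hop_ball E w (Suc p))" "{a', b'} \<in> E'"
    "switch E' a b a' b' = E"
proof -
  let ?A = "hop_ball E v (Suc p)" and ?B = "hop_ball E w (Suc p)"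
  have *: "(a, a') \<in> boundary E ?A" "a' \<notin> ?B" "(b, b') \<in> boundary E ?B" "b' \<notin> ?A"
     "a' \<noteq> b'" "{a', b'} \<notin> E" "{a, b} \<notin> E"
    using op by (auto simp: open_pairs_def)
  have mem: "a \<in> ?A" "a' \<notin> ?A" "{a, a'} \<in> E" "b \<in> ?B" "b' \<notin> ?B" "{b, b'} \<in> E"
    using * by (auto simp: boundary_def)
  have mem2: "a \<notin> ?B" "b \<notin> ?A" "a \<noteq> b" using mem disj by auto
  show "E' \<in> regular_graphs k N" unfolding E'_def using * mem mem2 by (intro switch_regular) auto
  \<comment> \<open>Otherwise a' or b' would lie in the ball of radius p + 1.\<close>
  have "a \<notin> hop_ball E v p" "b \<notin> hop_ball E w p"
    using mem ball_edge[of a E v p a'] ball_edge[of b E w p b'] by auto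
  moreover have "hop_ball E v p \<subseteq> ?A" "hop_ball E w p \<subseteq> ?B" by (rule ball_mono_Suc)+
  ultimately show "hop_ball E' v (Suc p) = ?A" "hop_ball E' w (Suc p) = ?B"
    unfolding E'_def using * mem mem2 by (auto intro!: ball_switch)
  have "boundary E' ?A = insert (a, b) (boundary E ?A - {(a, a')})"
    unfolding E'_def using * mem2 by (intro boundary_switch) auto
  moreover have "(a, b) \<notin> boundary E ?A" "(b, a) \<notin> boundary E ?B"
    using * by (auto simp: boundary_def insert_commute)
  ultimately show "card (boundary E' ?A) = card (boundary E ?A)"
    using card_exchange[OF finite_boundary *(1)] by simp
  have "boundary E' ?B = insert (b, a) (boundary E ?B - {(b, b')})"
    unfolding E'_def switch_commute[of E a] using * mem2 by (intro boundary_switch) auto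
  then show "card (boundary E' ?B) = card (boundary E ?B)"
    using card_exchange[OF finite_boundary *(3)] \<open>(b, a) \<notin> boundary E ?B\<close> by simp
  have cr: "cross_edges E' ?A ?B = insert (a, b) (cross_edges E ?A ?B)"
    unfolding E'_def using disj * mem by (intro cross_edges_switch) auto
  then show "(a, b) \<in> cross_edges E' ?A ?B" by simp
  have "(a, b) \<notin> cross_edges E ?A ?B" using * by (simp add: cross_edges_def)
  then show "card (cross_edges E' ?A ?B) = Suc (card (cross_edges E ?A ?B))"
    unfolding cr using finite_cross_edges by simp
  show "{a', b'} \<in> E'" unfolding E'_def switch_def by simp
  show "switch E' a b a' b' = E" unfolding E'_def using * mem by (intro switch_switch) auto
qed

end

text \<open>The exact value m suits a switching that adds exactly one cross edge. The lower bound r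
  on the boundaries is preserved by it.\<close>

definition cross_class :: "nat \<Rightarrow> nat \<Rightarrow> nat \<Rightarrow> nat \<Rightarrow> nat \<Rightarrow> nat \<Rightarrow> nat \<Rightarrow> nat set set set" where
  "cross_class k N v w p r m = {E \<in> regular_graphs k N.
     hop_ball E v (Suc p) \<inter> hop_ball E w (Suc p) = {} \<and>
     r \<le> card (boundary E (hop_ball E v (Suc p))) \<and> r \<le> card (boundary E (hop_ball E w (Suc p))) \<and>
     card (cross_edges E (hop_ball E v (Suc p)) (hop_ball E w (Suc p))) = m}"

text \<open>Forward there are s * s open pairs. Backward one picks a cross edge, m + 1 ways, and any
  oriented edge, k N ways.\<close>

lemma cross_class_step:
  assumes r: "s + m + 3 * k * k \<le> r"
  shows "card (cross_class k N v w p r m) * (s * s)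
     \<le> card (cross_class k N v w p r (Suc m)) * (Suc m * (k * N))"
proof -
  let ?F = "\<lambda>E. open_pairs E (hop_ball E v (Suc p)) (hop_ball E w (Suc p))"
  let ?G = "\<lambda>E. {((a, a'), (b, b')). (a, b) \<in> cross_edges E (hop_ball E v (Suc p)) (hop_ball E w (Suc p)) \<and> {a', b'} \<in> E}"
  let ?\<phi> = "\<lambda>E (e, f). switch E (fst e) (snd e) (fst f) (snd f)"
  let ?\<psi> = "\<lambda>E (e, f). switch E (fst e) (fst f) (snd e) (snd f)"
  have fin: "finite (cross_class k N v w p r i)" for i
    unfolding cross_class_def using finite_regular_graphs by auto
  have lower: "finite (?F E) \<and> s * s \<le> card (?F E)"
    and maps: "t \<in> ?F E \<longrightarrow> ?\<phi> E t \<in> cross_class k N v w p r (Suc m) \<and> t \<in> ?G (?\<phi> E t) \<and> ?\<psi> (?\<phi> E t) t = E"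
    if E: "E \<in> cross_class k N v w p r m" for E t
  proof -
    interpret regular_graph k N E using E by unfold_locales (simp add: cross_class_def)
    have E': "hop_ball E v (Suc p) \<inter> hop_ball E w (Suc p) = {}"
     "r \<le> card (boundary E (hop_ball E v (Suc p)))" "r \<le> card (boundary E (hop_ball E w (Suc p)))"
     "card (cross_edges E (hop_ball E v (Suc p)) (hop_ball E w (Suc p))) = m"
      using E by (auto simp: cross_class_def)
    show "finite (?F E) \<and> s * s \<le> card (?F E)"
      using finite_open_pairs r E' by (intro conjI card_open_pairs[of _ m]) auto
    show "t \<in> ?F E \<longrightarrow> ?\<phi> E t \<in> cross_class k N v w p r (Suc m) \<and> t \<in> ?G (?\<phi> E t) \<and> ?\<psi> (?\<phi> E t) t = E"
    proof
      assume "t \<in> ?F E"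
      then obtain a a' b b' where t: "t = ((a, a'), (b, b'))" and op: "((a, a'), (b, b')) \<in> ?F E"
        by (metis surj_pair)
      show "?\<phi> E t \<in> cross_class k N v w p r (Suc m) \<and> t \<in> ?G (?\<phi> E t) \<and> ?\<psi> (?\<phi> E t) t = E"
        using open_switch[OF E'(1) op] E' by (simp add: t cross_class_def)
    qed
  qed
  have upper: "finite (?G E) \<and> card (?G E) \<le> Suc m * (k * N)"
    if E: "E \<in> cross_class k N v w p r (Suc m)" for E
  proof -
    interpret regular_graph k N E using E by unfold_locales (simp add: cross_class_def)
    let ?C = "cross_edges E (hop_ball E v (Suc p)) (hop_ball E w (Suc p)) \<times> Sigma {..<N} (nbrs E)"
    have sub: "?G E \<subseteq> (\<lambda>((a, b), (a', b')). ((a, a'), (b, b'))) ` ?C"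
    proof
      fix t assume "t \<in> ?G E"
      then obtain a a' b b' where t: "t = ((a, a'), (b, b'))"
          "(a, b) \<in> cross_edges E (hop_ball E v (Suc p)) (hop_ball E w (Suc p))" "{a', b'} \<in> E"
        by auto
      then have "((a, b), (a', b')) \<in> ?C" using edge_D by auto
      then show "t \<in> (\<lambda>((a, b), (a', b')). ((a, a'), (b, b'))) ` ?C"
        by (rule rev_image_eqI) (simp add: t(1))
    qed
    have finC: "finite ?C" using finite_cross_edges finite_nbrs by auto
    have "card (?G E) \<le> card ?C"
      using card_mono[OF finite_imageI[OF finC] sub] card_image_le[OF finC] le_trans by blast
    also have "\<dots> = Suc m * (k * N)"
      using E degree_sum[of "{..<N}"] by (simp add: card_cartesian_product cross_class_def)
    finally show ?thesis using finite_subset[OF sub finite_imageI[OF finC]] by blast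
  qed
  show ?thesis
    by (rule double_counting[where F = ?F and G = ?G and \<phi> = ?\<phi> and \<psi> = ?\<psi>])
      (use fin lower upper maps in blast)+
qed

text \<open>A common vertex or a joining edge would give a walk from v to w of length at most 2 l +
  1. Far pairs therefore put the graph in the class with no cross edge.\<close>

lemma far_cases:
  assumes "w \<notin> hop_ball E v (2 * l + 1)"
  shows "hop_ball E v l \<inter> hop_ball E w l = {} \<and> cross_edges E (hop_ball E v l) (hop_ball E w l) = {}"
proof -
  have 1: False if "x \<in> hop_ball E v l" "x \<in> hop_ball E w l" for x
  proof -
    have "w \<in> hop_ball E v (l + l)" using that ball_sym ball_trans by blast
    then show False using assms ball_mono[of "l + l" "2 * l + 1"] by auto
  qed
  have 2: False if "x \<in> hop_ball E v l" "y \<in> hop_ball E w l" "{x, y} \<in> E" for x y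
  proof -
    have "w \<in> hop_ball E v (Suc l + l)"
      using that ball_sym ball_edge ball_trans by blast
    then show False using assms by (simp add: mult_2)
  qed
  show ?thesis using 1 2 by (auto simp: cross_edges_def)
qed

section \<open>Existence of regular graphs\<close>

lemma add_mod_inj:
  fixes u s t N :: nat
  assumes "(u + s) mod N = (u + t) mod N" "s < N" "t < N"
  shows "s = t"
proof -
  have *: "s = t" if "(u + s) mod N = (u + t) mod N" "s \<le> t" "t < N" for s t
  proof -
    have "N dvd (u + t) - (u + s)" using that by (subst mod_eq_dvd_iff_nat[symmetric]) auto
    then have "t - s = 0" using that by (metis add_diff_cancel_left dvd_imp_le le_less_trans diff_le_self neq0_conv not_le)
    then show ?thesis using that by simp
  qed
  show ?thesis using *[of s t] *[of t s] assms by (cases "s \<le> t") auto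
qed

text \<open>This is the Cayley graph of the cyclic group of order N with symmetric connection set
  S.\<close>

lemma circulant_regular:
  fixes S :: "nat set"
  assumes S: "S \<subseteq> {1..<N}" "card S = k" and sym: "\<And>s. s \<in> S \<Longrightarrow> N - s \<in> S"
  defines "E \<equiv> {{u, (u + s) mod N} | u s. u < N \<and> s \<in> S}"
  shows "E \<in> regular_graphs k N"
proof -
  have ne: "u \<noteq> (u + s) mod N" if "u < N" "s \<in> S" for u s
    using add_mod_inj[of u s N 0] that S by auto
  have "E \<subseteq> all_edges N"
  proof
    fix e assume "e \<in> E"
    then obtain u s where us: "e = {u, (u + s) mod N}" "u < N" "s \<in> S" unfolding E_def by blast
    moreover have "(u + s) mod N < N" using us by (intro mod_less_divisor) simp
    ultimately show "e \<in> all_edges N" using ne[of u s] unfolding all_edges_def by blast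
  qed
  moreover have "card {e \<in> E. u \<in> e} = k" if u: "u < N" for u
  proof -
    have "{e \<in> E. u \<in> e} = (\<lambda>s. {u, (u + s) mod N}) ` S"
    proof
      show "{e \<in> E. u \<in> e} \<subseteq> (\<lambda>s. {u, (u + s) mod N}) ` S"
      proof
        fix e assume "e \<in> {e \<in> E. u \<in> e}"
        then obtain x s where xs: "e = {x, (x + s) mod N}" "x < N" "s \<in> S" "u \<in> e" unfolding E_def by blast
        show "e \<in> (\<lambda>s. {u, (u + s) mod N}) ` S"
        proof (cases "u = x")
          case False
          \<comment> \<open>Seen from its other end, the edge belongs to the generator N -
            s.\<close>
          then have ux: "u = (x + s) mod N" using xs by auto
          have "(u + (N - s)) mod N = (x + s + (N - s)) mod N" unfolding ux by (rule mod_add_left_eq)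
          also have "\<dots> = x" using xs S by (auto simp: subset_iff)
          finally have "e = {u, (u + (N - s)) mod N}" using xs ux by auto
          then show ?thesis using sym[OF xs(3)] by blast
        qed (use xs in auto)
      qed
    qed (use u in \<open>auto simp: E_def\<close>)
    moreover have "inj_on (\<lambda>s. {u, (u + s) mod N}) S"
    proof (rule inj_onI)
      fix s t assume st: "s \<in> S" "t \<in> S" "{u, (u + s) mod N} = {u, (u + t) mod N}"
      then have "(u + s) mod N = (u + t) mod N"
        using ne[OF u st(1)] ne[OF u st(2)] by (auto simp: doubleton_eq_iff)
      moreover have "s < N" "t < N" using st S by (auto simp: subset_iff)
      ultimately show "s = t" by (rule add_mod_inj)
    qed
    ultimately show ?thesis using S by (simp add: card_image)
  qed
  ultimately show ?thesis unfolding regular_graphs_def by blast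
qed

text \<open>Needed for the uniform distribution to be meaningful. The connection set is 1, ..., h
  and the negatives; for odd k, N is even and the self-inverse element N / 2 is added.\<close>

lemma regular_graphs_nonempty:
  assumes "even (k * N)" "k < N"
  shows "regular_graphs k N \<noteq> {}"
proof -
  define h where "h = k div 2"
  have "\<exists>S. S \<subseteq> {1..<N} \<and> card S = k \<and> (\<forall>s\<in>S. N - s \<in> S)"
  proof (cases "even k")
    case True
    then have k: "k = 2 * h" by (simp add: h_def)
    have "card ({1..h} \<union> {N - h..<N}) = k"
      using assms k by (subst card_Un_disjoint) auto
    then show ?thesis using assms k by (intro exI[of _ "{1..h} \<union> {N - h..<N}"]) auto
  next
    case False
    then have k: "k = 2 * h + 1" by (simp add: h_def)
    from False assms obtain m where m: "N = 2 * m" by (auto elim: evenE)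
    have "card ({1..h} \<union> {N - h..<N}) = 2 * h"
      using assms k by (subst card_Un_disjoint) auto
    then have "card (insert m ({1..h} \<union> {N - h..<N})) = k"
      using assms k m by (subst card_insert_disjoint) auto
    then show ?thesis using assms k m by (intro exI[of _ "insert m ({1..h} \<union> {N - h..<N})"]) auto
  qed
  then obtain S where "S \<subseteq> {1..<N}" "card S = k" "\<forall>s\<in>S. N - s \<in> S" by blast
  then show ?thesis using circulant_regular[of S N k] by blast
qed

section \<open>Counting graphs with a far pair\<close>

text \<open>With K = k - 1, the recursion b' \<ge> K b - 2 x becomes multiplicative for b - 2 x,
  since K \<ge> 2 gives 2 x K - 2 x \<ge> 2 x.\<close>

lemma (in regular_graph) ball_growth_iterate:
  fixes x :: int
  assumes k: "k \<ge> 3" and v: "v < N" and x: "x \<ge> 0"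
    and exc: "\<And>l. l < a + i \<Longrightarrow> (\<Sum>p<l. newexc E v p) \<le> x"
  shows "int (card (hop_ball E v (a + i))) \<ge> (int k - 1) ^ i * (int (card (hop_ball E v a)) - 2 * x) + 2 * x"
  using exc
proof (induction i)
  case (Suc i)
  let ?c = "int (card (hop_ball E v a))"
  have IH: "(int k - 1) ^ i * (?c - 2 * x) + 2 * x \<le> int (card (hop_ball E v (a + i)))"
    using Suc by simp
  have "(int k - 1) ^ Suc i * (?c - 2 * x) + 2 * x \<le> (int k - 1) * ((int k - 1) ^ i * (?c - 2 * x) + 2 * x) - 2 * x"
    using k x mult_right_mono[of 2 "int k - 1" x] by (simp add: algebra_simps)
  also have "\<dots> \<le> (int k - 1) * int (card (hop_ball E v (a + i))) - 2 * x"
    using IH k by (simp add: mult_left_mono)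
  also have "\<dots> \<le> (int k - 1) * int (card (hop_ball E v (a + i))) - 2 * (\<Sum>p<a + i. newexc E v p)"
    using Suc.prems[of "a + i"] by simp
  also have "\<dots> \<le> int (card (hop_ball E v (a + Suc i)))"
    using ball_growth(1)[OF v, of "a + i"] by simp
  finally show ?case .
qed simp

definition expanding :: "nat set set \<Rightarrow> nat \<Rightarrow> nat \<Rightarrow> nat \<Rightarrow> nat \<Rightarrow> nat \<Rightarrow> bool" where
  "expanding E v L0 L1 L Q \<longleftrightarrow> (\<forall>p<L0. newexc E v p < 1) \<and> (\<forall>p<L1. newexc E v p < 2) \<and> (\<forall>p<L. newexc E v p < int Q)"

text \<open>The first stage grows like the tree; at the start of each later stage the ball is so
  large that the stage's total excess costs at most a factor 2. A last factor 2 is lost in passing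
  from the ball to its boundary.\<close>

lemma (in regular_graph) expanding_boundary:
  assumes k: "k \<ge> 3" and v: "v < N" and e: "expanding E v L0 L1 L Q"
    and L: "L0 \<le> L1" "L1 < L"
    and c0: "4 * L1 \<le> (k - 1) ^ L0" and c1: "8 * (L1 + L * Q) \<le> (k - 1) ^ L1"
  shows "(k - 1) ^ L \<le> 8 * card (boundary E (hop_ball E v L))"
proof -
  let ?K = "int k - 1" and ?b = "\<lambda>l. int (card (hop_ball E v l))" and ?x = "int (L1 + L * Q)"
  have K: "int (k - 1) = ?K" using k by simp
  have s0: "(\<Sum>p<l. newexc E v p) \<le> 0" if "l < L0 + 1" for l
  proof (rule sum_nonpos)
    fix p assume "p \<in> {..<l}"
    then have "p < L0" using that by simp
    then show "newexc E v p \<le> 0" using e unfolding expanding_def by force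
  qed
  have s1: "(\<Sum>p<l. newexc E v p) \<le> int L1" if "l \<le> L1" for l
  proof -
    have "(\<Sum>p<l. newexc E v p) \<le> (\<Sum>p<l. 1)"
    proof (rule sum_mono)
      fix p assume "p \<in> {..<l}"
      then have "p < L1" using that by simp
      then show "newexc E v p \<le> 1" using e unfolding expanding_def by force
    qed
    then show ?thesis using that by simp
  qed
  have s2: "(\<Sum>p<l. newexc E v p) \<le> ?x" if "l \<le> L" for l
  proof -
    have "(\<Sum>p<l. newexc E v p) \<le> (\<Sum>p<l. int Q)"
    proof (rule sum_mono)
      fix p assume "p \<in> {..<l}"
      then have "p < L" using that by simp
      then show "newexc E v p \<le> int Q" using e unfolding expanding_def by force
    qed
    also have "\<dots> \<le> int (L * Q)" using that by (simp add: mult_right_mono)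
    finally show ?thesis by simp
  qed
  have c0': "4 * int L1 \<le> ?K ^ L0" and c1': "8 * ?x \<le> ?K ^ L1"
    using of_nat_mono[OF c0, where 'a = int] of_nat_mono[OF c1, where 'a = int]
    by (simp_all only: of_nat_power K of_nat_mult of_nat_numeral)
  have b0: "?b L0 \<ge> ?K ^ L0"
    using ball_growth_iterate[OF k v, of 0 0 L0] s0 by simp
  have b1: "2 * ?b L1 \<ge> ?K ^ L1"
  proof -
    have "?K ^ L1 = ?K ^ (L1 - L0) * ?K ^ L0" using L by (simp flip: power_add)
    also have "\<dots> \<le> ?K ^ (L1 - L0) * (2 * (?b L0 - 2 * int L1))"
      using b0 c0' k by (intro mult_left_mono) auto
    also have "\<dots> \<le> 2 * ?b L1"
    proof -
      have "?K ^ (L1 - L0) * (?b L0 - 2 * int L1) + 2 * int L1 \<le> ?b (L0 + (L1 - L0))"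
        by (rule ball_growth_iterate[OF k v]) (use s1 L in auto)
      then have "?K ^ (L1 - L0) * (?b L0 - 2 * int L1) \<le> ?b L1" using L by simp
      then show ?thesis by (subst mult.left_commute) linarith
    qed
    finally show ?thesis .
  qed
  have b2: "4 * ?b L \<ge> ?K ^ L"
  proof -
    have "?K ^ L = ?K ^ (L - L1) * ?K ^ L1" using L by (simp flip: power_add)
    also have "\<dots> \<le> ?K ^ (L - L1) * (4 * (?b L1 - 2 * ?x))"
      using b1 c1' k by (intro mult_left_mono) auto
    also have "\<dots> \<le> 4 * ?b L"
    proof -
      have "?K ^ (L - L1) * (?b L1 - 2 * ?x) + 2 * ?x \<le> ?b (L1 + (L - L1))"
        by (rule ball_growth_iterate[OF k v]) (use s2 L in auto)
      moreover have "L1 + (L - L1) = L" "0 \<le> ?x" using L by simp_all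
      ultimately have "?K ^ (L - L1) * (?b L1 - 2 * ?x) \<le> ?b L" by (simp only:)
      then show ?thesis by (subst mult.left_commute) linarith
    qed
    finally show ?thesis .
  qed
  have "?b L \<le> (int k - 2) * ?b L" using k mult_right_mono[of 1 "int k - 2" "?b L"] by simp
  then have b3: "?b L - 2 * ?x \<le> int (card (boundary E (hop_ball E v L)))"
  proof -
    have "?b L - 2 * ?x \<le> (int k - 2) * ?b L - 2 * (\<Sum>p<L. newexc E v p)"
      using \<open>?b L \<le> (int k - 2) * ?b L\<close> s2[OF order_refl] by (intro diff_mono mult_left_mono) auto
    then show ?thesis using ball_growth(2)[OF v, of L] by (rule order_trans)
  qed
  have "2 * ?K ^ L1 \<le> ?K * ?K ^ L1" using k by (intro mult_right_mono) auto
  also have "\<dots> = ?K ^ Suc L1" by simp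
  also have "\<dots> \<le> ?K ^ L" using L k by (intro power_increasing) auto
  finally have "16 * ?x \<le> ?K ^ L" using c1' by linarith
  then have "?K ^ L \<le> 8 * int (card (boundary E (hop_ball E v L)))" using b2 b3 by linarith
  then have "int ((k - 1) ^ L) \<le> int (8 * card (boundary E (hop_ball E v L)))"
    by (simp only: of_nat_power K of_nat_mult of_nat_numeral)
  then show ?thesis by (simp only: of_nat_le_iff)
qed

lemma excess_class_bound:
  assumes k: "k \<ge> 3" and v: "v < N"
    and large: "N + 2 * k * (3 * (k - 1) ^ (p + 2)) + k * k \<le> k * N"
  defines "\<beta> \<equiv> (3 * real (k - 1) ^ (p + 2) * real k)\<^sup>2 / real N"
  shows "real (card (excess_class k N v p (Suc j))) \<le> \<beta> / real (Suc j) * real (card (excess_class k N v p j))"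
proof -
  have N: "N > 0" using v by simp
  have "real (card (excess_class k N v p (Suc j)) * (Suc j * N))
      \<le> real (card (excess_class k N v p j) * (3 * (k - 1) ^ (p + 2) * k)\<^sup>2)"
    using excess_class_step[OF k v large, of j] of_nat_mono by blast
  also have "\<dots> = real (card (excess_class k N v p j)) * (\<beta> * real N)"
    using N by (simp add: \<beta>_def)
  finally have "real (card (excess_class k N v p (Suc j))) * real (Suc j) * real N
      \<le> real (card (excess_class k N v p j)) * \<beta> * real N" by (simp only: of_nat_mult mult.assoc)
  then have "real (card (excess_class k N v p (Suc j))) * real (Suc j) \<le> real (card (excess_class k N v p j)) * \<beta>"
    using N by (simp add: mult_le_cancel_right)
  then show ?thesis by (simp add: field_simps del: of_nat_Suc)
qed

lemma excess_class_le: "card (excess_class k N v p j) \<le> card (regular_graphs k N)"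
  unfolding excess_class_def by (intro card_mono finite_regular_graphs) auto

text \<open>The ratio of consecutive classes is at most \<beta> / (j + 1), hence at most one half
  once j reaches J \<ge> 2 \<beta>.\<close>

lemma excess_class_tail:
  assumes k: "k \<ge> 3" and v: "v < N"
    and large: "N + 2 * k * (3 * (k - 1) ^ (p + 2)) + k * k \<le> k * N"
    and J: "2 * ((3 * real (k - 1) ^ (p + 2) * real k)\<^sup>2 / real N) \<le> real J"
  shows "real (card (excess_class k N v p (J + t))) \<le> (1/2) ^ t * real (card (regular_graphs k N))"
proof (induction t)
  case 0
  then show ?case using excess_class_le by simp
next
  case (Suc t)
  let ?\<beta> = "(3 * real (k - 1) ^ (p + 2) * real k)\<^sup>2 / real N"
  have "real (card (excess_class k N v p (J + Suc t))) \<le> ?\<beta> / real (Suc (J + t)) * real (card (excess_class k N v p (J + t)))"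
    using excess_class_bound[OF k v large, of "J + t"] by simp
  also have "\<dots> \<le> 1/2 * real (card (excess_class k N v p (J + t)))"
  proof -
    have "b / real (Suc (J + t)) \<le> 1/2" if "2 * b \<le> real J" for b :: real
      using that by (simp add: field_simps)
    from this[OF J] show ?thesis by (intro mult_right_mono) auto
  qed
  also have "\<dots> \<le> 1/2 * ((1/2) ^ t * real (card (regular_graphs k N)))"
    using Suc by (intro mult_left_mono) auto
  finally show ?case by simp
qed

text \<open>For m < t the s * s forward choices are at least twice the (m + 1) k N backward ones, so
  the classes at least double t times in a row.\<close>

lemma cross_class_0:
  assumes N: "N > 0" and r: "s + t + 3 * k * k \<le> r" and s: "2 * t * k * N \<le> s * s" "s > 0"
  shows "real (card (cross_class k N v w p r 0)) \<le> (1/2) ^ t * real (card (regular_graphs k N))"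
proof -
  have "real (card (cross_class k N v w p r 0)) \<le> (1/2) ^ m * real (card (cross_class k N v w p r m))"
    if "m \<le> t" for m
    using that
  proof (induction m)
    case (Suc m)
    let ?c = "\<lambda>m. card (cross_class k N v w p r m)"
    have "?c m * (s * s) \<le> ?c (Suc m) * (Suc m * (k * N))"
      using r Suc.prems by (intro cross_class_step) linarith
    then have "2 * ?c m * (s * s) \<le> ?c (Suc m) * (2 * Suc m * k * N)" by (simp add: algebra_simps)
    also have "\<dots> \<le> ?c (Suc m) * (2 * t * k * N)"
      using Suc.prems by (intro mult_le_mono2 mult_le_mono1) simp
    also have "\<dots> \<le> ?c (Suc m) * (s * s)" using s by (intro mult_le_mono2) simp
    finally have "2 * ?c m \<le> ?c (Suc m)" using s by simp
    then have "2 * real (?c m) \<le> real (?c (Suc m))" by linarith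
    then have "(1/2) ^ Suc m * (2 * real (?c m)) \<le> (1/2) ^ Suc m * real (?c (Suc m))"
      by (rule mult_left_mono) simp
    moreover have "real (?c 0) \<le> (1/2) ^ Suc m * (2 * real (?c m))" using Suc by simp
    ultimately show ?case by linarith
  qed simp
  from this[of t] have "real (card (cross_class k N v w p r 0)) \<le> (1/2) ^ t * real (card (cross_class k N v w p r t))"
    by simp
  also have "\<dots> \<le> (1/2) ^ t * real (card (regular_graphs k N))"
    unfolding cross_class_def using finite_regular_graphs
    by (intro mult_left_mono of_nat_mono card_mono) auto
  finally show ?thesis .
qed

section \<open>Failure probabilities for fixed parameters\<close>

lemma sum_power_le:
  fixes x :: real
  assumes "x \<ge> 2"
  shows "(\<Sum>p<n. x ^ p) \<le> x ^ n"
proof (induction n)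
  case (Suc n)
  have "2 * x ^ n \<le> x * x ^ n" using assms by (intro mult_right_mono) auto
  then show ?case using Suc by simp
qed simp

text \<open>The radii L0, L1, L end the stages of \<open>expanding\<close>, taken with Q = J + t.
  From J on, every further excess edge halves the count, and t halvings follow. The exponent L + 1
  covers p + 2 for all levels p < L.\<close>

locale expansion_parameters =
  fixes k N L0 L1 L J t :: nat
  assumes k: "k \<ge> 3" and N: "N > 0"
    and L: "L0 \<le> L1" "L1 < L"
    and large: "N + 2 * k * (3 * (k - 1) ^ (L + 1)) + k * k \<le> k * N"
    and J: "2 * ((3 * real (k - 1) ^ (L + 1) * real k)\<^sup>2 / real N) \<le> real J"
    and c0: "4 * L1 \<le> (k - 1) ^ L0" and c1: "8 * (L1 + L * (J + t)) \<le> (k - 1) ^ L1"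
begin

abbreviation "graphs \<equiv> real (card (regular_graphs k N))"

definition "\<gamma> = (3 * real (k - 1) ^ 2 * real k)\<^sup>2 / real N"

lemma gamma: "(3 * real (k - 1) ^ (p + 2) * real k)\<^sup>2 / real N = \<gamma> * (real (k - 1) ^ 2) ^ p"
  unfolding \<gamma>_def by (simp add: power_mult_distrib power_add algebra_simps flip: power_mult)

lemma gamma_nonneg: "\<gamma> \<ge> 0"
  unfolding \<gamma>_def by simp

definition "nonexpanding v = {E \<in> regular_graphs k N. \<not> expanding E v L0 L1 L (J + t)}"

text \<open>One term per stage: any excess below L0, two excess edges at a level below L1, and J + t
  excess edges at a level below L.\<close>

definition "\<epsilon> = \<gamma> * (real (k - 1) ^ 2) ^ L0 + real L1 * (\<gamma> * (real (k - 1) ^ 2) ^ L1)\<^sup>2 + real L * (1/2) ^ t"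

lemma card_nonexpanding:
  assumes v: "v < N"
  shows "real (card (nonexpanding v)) \<le> \<epsilon> * graphs"
proof -
  let ?e = "\<lambda>p j. real (card (excess_class k N v p j))" and ?q = "real (k - 1) ^ 2"
  have q: "?q \<ge> 2"
    using k power_mono[of 2 "real (k - 1)" 2] by simp
  have large': "N + 2 * k * (3 * (k - 1) ^ (p + 2)) + k * k \<le> k * N" if "p < L" for p
  proof -
    have "(k - 1) ^ (p + 2) \<le> (k - 1) ^ (L + 1)" using that k by (intro power_increasing) auto
    then have "2 * k * (3 * (k - 1) ^ (p + 2)) \<le> 2 * k * (3 * (k - 1) ^ (L + 1))" by simp
    then show ?thesis using large by linarith
  qed
  have 1: "?e p 1 \<le> \<gamma> * ?q ^ p * graphs" if "p < L" for p
  proof -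
    have "?e p 1 \<le> \<gamma> * ?q ^ p * ?e p 0"
      using excess_class_bound[OF k v large'[OF that], of 0] unfolding gamma by simp
    also have "\<dots> \<le> \<gamma> * ?q ^ p * graphs"
      using gamma_nonneg excess_class_le by (intro mult_left_mono) auto
    finally show ?thesis .
  qed
  have 2: "?e p 2 \<le> (\<gamma> * ?q ^ L1)\<^sup>2 * graphs" if p: "p < L1" for p
  proof -
    have "?e p 2 \<le> \<gamma> * ?q ^ p / 2 * ?e p 1"
      using excess_class_bound[OF k v large', of p 1] p L unfolding gamma by (simp add: numeral_2_eq_2)
    also have "\<dots> \<le> \<gamma> * ?q ^ p * ?e p 1"
      using gamma_nonneg by (intro mult_right_mono) auto
    also have "\<dots> \<le> \<gamma> * ?q ^ p * (\<gamma> * ?q ^ p * graphs)"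
      using 1[of p] p L gamma_nonneg by (intro mult_left_mono) auto
    also have "\<dots> = (\<gamma> * ?q ^ p)\<^sup>2 * graphs" by (simp add: power2_eq_square)
    also have "\<dots> \<le> (\<gamma> * ?q ^ L1)\<^sup>2 * graphs"
      using gamma_nonneg p q
      by (intro mult_right_mono power_mono mult_left_mono power_increasing) auto
    finally show ?thesis .
  qed
  have 3: "?e p (J + t) \<le> (1/2) ^ t * graphs" if p: "p < L" for p
  proof (rule excess_class_tail[OF k v large'[OF p]])
    have "2 * ((3 * real (k - 1) ^ (p + 2) * real k)\<^sup>2 / real N) \<le> 2 * ((3 * real (k - 1) ^ (L + 1) * real k)\<^sup>2 / real N)"
      using p k
      by (intro mult_left_mono divide_right_mono power_mono mult_right_mono power_increasing) auto
    then show "2 * ((3 * real (k - 1) ^ (p + 2) * real k)\<^sup>2 / real N) \<le> real J" using J by linarith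
  qed
  have sub: "nonexpanding v \<subseteq> (\<Union>p<L0. excess_class k N v p 1) \<union> (\<Union>p<L1. excess_class k N v p 2)
      \<union> (\<Union>p<L. excess_class k N v p (J + t))" (is "_ \<subseteq> ?U0 \<union> ?U1 \<union> ?U2")
    unfolding nonexpanding_def expanding_def excess_class_def by (auto simp: not_less)
  have fin: "finite (excess_class k N v p j)" for p j
    unfolding excess_class_def using finite_regular_graphs by simp
  have "card (nonexpanding v) \<le> card (?U0 \<union> ?U1 \<union> ?U2)"
    using sub fin by (intro card_mono) auto
  also have "\<dots> \<le> card ?U0 + card ?U1 + card ?U2"
    by (meson add_le_mono1 card_Un_le le_trans)
  also have "\<dots> \<le> (\<Sum>p<L0. card (excess_class k N v p 1)) + (\<Sum>p<L1. card (excess_class k N v p 2))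
      + (\<Sum>p<L. card (excess_class k N v p (J + t)))"
    by (intro add_mono card_UN_le) auto
  finally have "real (card (nonexpanding v)) \<le> (\<Sum>p<L0. ?e p 1) + (\<Sum>p<L1. ?e p 2) + (\<Sum>p<L. ?e p (J + t))"
    by (simp flip: of_nat_sum of_nat_add)
  also have "\<dots> \<le> (\<Sum>p<L0. \<gamma> * ?q ^ p * graphs) + (\<Sum>p<L1. (\<gamma> * ?q ^ L1)\<^sup>2 * graphs) + (\<Sum>p<L. (1/2) ^ t * graphs)"
    using L by (intro add_mono sum_mono 1 2 3) auto
  also have "\<dots> = \<gamma> * (\<Sum>p<L0. ?q ^ p) * graphs + real L1 * (\<gamma> * ?q ^ L1)\<^sup>2 * graphs + real L * (1/2) ^ t * graphs"
    by (simp add: sum_distrib_left sum_distrib_right)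
  \<comment> \<open>The geometric sum is bounded by the next power, which avoids a factor L0; this
    keeps the first term at order (log N)^2 / N.\<close>
  also have "\<dots> \<le> \<gamma> * ?q ^ L0 * graphs + real L1 * (\<gamma> * ?q ^ L1)\<^sup>2 * graphs + real L * (1/2) ^ t * graphs"
    using sum_power_le[OF q] gamma_nonneg
    by (intro add_mono mult_right_mono mult_left_mono) auto
  finally show ?thesis unfolding \<epsilon>_def by (simp add: algebra_simps)
qed

text \<open>If the balls around both ends expand, both boundaries have at least r pairs, and a far
  pair then places the graph in \<open>cross_class\<close> with no cross edge.\<close>

lemma card_far:
  assumes vw: "v < N" "w < N"
    and r: "8 * r \<le> (k - 1) ^ L" "s + t + 3 * k * k \<le> r" and s: "2 * t * k * N \<le> s * s" "s > 0"
  shows "real (card {E \<in> regular_graphs k N. w \<notin> hop_ball E v (2 * L + 1)}) \<le> (2 * \<epsilon> + (1/2) ^ t) * graphs"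
proof -
  obtain p where p: "L = Suc p" using L by (cases L) auto
  have "{E \<in> regular_graphs k N. w \<notin> hop_ball E v (2 * L + 1)}
      \<subseteq> nonexpanding v \<union> nonexpanding w \<union> cross_class k N v w p r 0"
  proof safe
    fix E assume E: "E \<in> regular_graphs k N" "w \<notin> hop_ball E v (2 * L + 1)"
      and c: "E \<notin> cross_class k N v w p r 0" and w: "E \<notin> nonexpanding w"
    interpret regular_graph k N E by unfold_locales fact
    show "E \<in> nonexpanding v"
    proof (rule ccontr)
      assume v: "E \<notin> nonexpanding v"
      have "r \<le> card (boundary E (hop_ball E u L))" if "u = v \<or> u = w" for u
      proof -
        have "expanding E u L0 L1 L (J + t)" "u < N" using that v w E vw by (auto simp: nonexpanding_def)
        then show ?thesis using expanding_boundary[OF k _ _ L c0 c1, of u] r by fastforce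
      qed
      then have "E \<in> cross_class k N v w p r 0"
        using far_cases[OF E(2)] E unfolding cross_class_def p by simp
      then show False using c by simp
    qed
  qed
  moreover have "finite (nonexpanding v \<union> nonexpanding w \<union> cross_class k N v w p r 0)"
    unfolding nonexpanding_def cross_class_def using finite_regular_graphs by simp
  ultimately have "card {E \<in> regular_graphs k N. w \<notin> hop_ball E v (2 * L + 1)}
      \<le> card (nonexpanding v \<union> nonexpanding w \<union> cross_class k N v w p r 0)"
    by (rule card_mono[rotated])
  also have "\<dots> \<le> card (nonexpanding v) + card (nonexpanding w) + card (cross_class k N v w p r 0)"
    by (meson add_le_mono1 card_Un_le le_trans)
  finally have "real (card {E \<in> regular_graphs k N. w \<notin> hop_ball E v (2 * L + 1)})
      \<le> real (card (nonexpanding v)) + real (card (nonexpanding w)) + real (card (cross_class k N v w p r 0))"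
    by linarith
  also have "\<dots> \<le> \<epsilon> * graphs + \<epsilon> * graphs + (1/2) ^ t * graphs"
    using vw N r s by (intro add_mono card_nonexpanding cross_class_0) auto
  finally show ?thesis by (simp add: algebra_simps)
qed

lemma sum_far_pairs:
  assumes r: "8 * r \<le> (k - 1) ^ L" "s + t + 3 * k * k \<le> r" and s: "2 * t * k * N \<le> s * s" "s > 0"
  shows "(\<Sum>E\<in>regular_graphs k N. real (card (far_pairs N (2 * L + 1) E)))
      \<le> (real N)\<^sup>2 * ((2 * \<epsilon> + (1/2) ^ t) * graphs)"
proof -
  let ?I = "\<lambda>E (v, w). if w \<notin> hop_ball E v (2 * L + 1) then 1 else 0 :: real"
  have "real (card (far_pairs N (2 * L + 1) E)) \<le> (\<Sum>e\<in>{..<N} \<times> {..<N}. ?I E e)" for E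
  proof -
    have "far_pairs N (2 * L + 1) E \<subseteq> {e \<in> {..<N} \<times> {..<N}. snd e \<notin> hop_ball E (fst e) (2 * L + 1)}"
      by (auto simp: far_pairs_def)
    then have "card (far_pairs N (2 * L + 1) E) \<le> card {e \<in> {..<N} \<times> {..<N}. snd e \<notin> hop_ball E (fst e) (2 * L + 1)}"
      by (intro card_mono) auto
    also have "real \<dots> = (\<Sum>e\<in>{..<N} \<times> {..<N}. ?I E e)"
      by (simp add: case_prod_beta' sum.If_cases Int_def)
    finally show ?thesis by simp
  qed
  then have "(\<Sum>E\<in>regular_graphs k N. real (card (far_pairs N (2 * L + 1) E)))
      \<le> (\<Sum>E\<in>regular_graphs k N. \<Sum>e\<in>{..<N} \<times> {..<N}. ?I E e)"
    by (intro sum_mono)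
  also have "\<dots> = (\<Sum>e\<in>{..<N} \<times> {..<N}. \<Sum>E\<in>regular_graphs k N. ?I E e)"
    by (rule sum.swap)
  also have "\<dots> \<le> (\<Sum>e\<in>{..<N} \<times> {..<N}. (2 * \<epsilon> + (1/2) ^ t) * graphs)"
  proof (rule sum_mono)
    fix e assume "e \<in> {..<N} \<times> {..<N}"
    moreover have "(\<Sum>E\<in>regular_graphs k N. ?I E e)
        = real (card {E \<in> regular_graphs k N. snd e \<notin> hop_ball E (fst e) (2 * L + 1)})"
      using finite_regular_graphs by (simp add: case_prod_beta' sum.If_cases Int_def)
    ultimately show "(\<Sum>E\<in>regular_graphs k N. ?I E e) \<le> (2 * \<epsilon> + (1/2) ^ t) * graphs"
      using card_far[OF _ _ r s] by auto
  qed
  finally show ?thesis by (simp add: card_cartesian_product power2_eq_square)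
qed

end

section \<open>Asymptotics\<close>

lemma ex_power_between:
  fixes K \<rho> :: real
  assumes "K \<ge> 2" "\<rho> \<ge> 1"
  shows "\<exists>l::nat. \<rho> \<le> K ^ l \<and> K ^ l \<le> K * \<rho>"
proof -
  define l where "l = (LEAST l. \<rho> \<le> K ^ l)"
  have "\<exists>l. \<rho> \<le> K ^ l" using real_arch_pow[of K \<rho>] assms by (auto intro: less_imp_le)
  then have l: "\<rho> \<le> K ^ l" unfolding l_def by (rule LeastI_ex)
  have "K ^ l \<le> K * \<rho>"
  proof (cases l)
    case 0
    then show ?thesis using assms mult_mono[of 1 K 1 \<rho>] by simp
  next
    case (Suc m)
    then have "m < (LEAST l. \<rho> \<le> K ^ l)" by (simp add: l_def)
    then have "\<not> \<rho> \<le> K ^ m" by (rule not_less_Least)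
    then show ?thesis using Suc assms by simp
  qed
  with l show ?thesis by blast
qed

text \<open>Up to a factor K the radii are chosen by \<open>K ^ L0\<close> = 12 g,
  \<open>K ^ L1\<close> = n^(1/8), \<open>K ^ L\<close> = sqrt n * g. The witness is d = 2 L + 1, so
  \<open>K ^ d\<close> is at most K^3 n g^2, and the number of radii supplies the third factor
  g.\<close>

lemma far_pairs_sparse:
  fixes k N :: nat
  defines "K \<equiv> real (k - 1)" and "n \<equiv> real N" and "g \<equiv> log (real k) (real N)" and "D \<equiv> (3 * real (k - 1) ^ 2 * real k)\<^sup>2"
  assumes k: "k \<ge> 3" and N: "N > 0"
    and E0: "g \<ge> 1" "g \<le> sqrt n"
    and E1: "24 * g * (2 * D * K\<^sup>2 * g\<^sup>2 + 4 * ln n + 3) \<le> n powr (1/8)"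
    and E2: "12 * K * g < n powr (1/8)"
    and E3: "K * n powr (1/8) < sqrt n * g"
    and E4: "6 * real k * K\<^sup>2 * (sqrt n * g) + (real k)\<^sup>2 \<le> 2 * n"
    and E5: "sqrt n * g / 16 + 1 + (4 * ln n + 1) + 3 * (real k)\<^sup>2 \<le> sqrt n * g / 8"
    and E6: "512 * (4 * ln n + 1) * real k \<le> g\<^sup>2"
    and E9: "6 * g * D\<^sup>2 * K ^ 4 / sqrt n + 6 * g / n + 1 / n \<le> g\<^sup>2"
  shows "\<exists>d. 9 * real (d + 1) * real (k - 1) ^ d \<le> 72 * K ^ 3 * n * g ^ 3 \<and>
     (\<Sum>E\<in>regular_graphs k N. real (card (far_pairs N d E)))
      \<le> n * ((288 * D * K\<^sup>2 + 1) * g\<^sup>2) * real (card (regular_graphs k N))"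
proof -
  have K2: "K \<ge> 2" and n0: "n \<ge> 1" using k N by (auto simp: K_def n_def)
  have Kk: "real k = K + 1" using k by (simp add: K_def)
  have n8: "n powr (1/8) \<ge> 1" using n0 by (simp add: ge_one_powr_ge_zero)
  have sq: "sqrt n \<ge> 1" "sqrt n * sqrt n = n" using n0 by auto
  have ln0: "ln n \<ge> 0" using n0 by simp
  have sg: "sqrt n * g \<ge> 1" using sq E0 mult_mono[of 1 "sqrt n" 1 g] by simp
  obtain L where KL: "sqrt n * g \<le> K ^ L" "K ^ L \<le> K * (sqrt n * g)"
    using ex_power_between[OF K2 sg] by blast
  \<comment> \<open>A small power of n: it exceeds the polylogarithmic excess of the last stage,
    while its fourth power, which enters \<epsilon>, is only sqrt n.\<close>
  obtain L1 where KL1: "n powr (1/8) \<le> K ^ L1" "K ^ L1 \<le> K * n powr (1/8)"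
    using ex_power_between[OF K2 n8] by blast
  \<comment> \<open>12 g dominates 4 L1, because L1 < L \<le> 3 g is shown below.\<close>
  obtain L0 where KL0: "12 * g \<le> K ^ L0" "K ^ L0 \<le> K * (12 * g)"
    using ex_power_between[OF K2, of "12 * g"] E0 by auto
  \<comment> \<open>Chosen so that 2^(-t) is at most 1 / n^2, negligible even after summing over all
    pairs.\<close>
  define t where "t = nat \<lceil>2 * log 2 n\<rceil>"
  define J where "J = nat \<lceil>2 * D * K\<^sup>2 * g\<^sup>2\<rceil>"
  have K1: "K > 1" using K2 by simp
  have L01: "L0 \<le> L1"
  proof -
    have "K ^ L0 < K ^ L1" using KL0 KL1 E2 by linarith
    then show ?thesis using K1 by simp
  qed
  have L12: "L1 < L"
  proof -
    have "K ^ L1 < K ^ L" using KL KL1 E3 by linarith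
    then show ?thesis using K1 by simp
  qed
  have Lg: "real L \<le> 3 * g"
  proof -
    have "K ^ L \<le> K * n"
      using KL E0 sq mult_left_mono[of g "sqrt n" "sqrt n"] K2 by (smt (verit) mult_left_mono)
    then have "ln (K ^ L) \<le> ln (K * n)" using K1 n0 by simp
    then have "real L * ln K \<le> ln K + ln n" using K1 n0 by (simp add: ln_realpow ln_mult)
    moreover have "ln n = g * ln (real k)" using k by (simp add: g_def n_def log_def)
    \<comment> \<open>Since k = K + 1 \<le> K^2, a logarithm to base K is at most twice one to base
      k; this converts the bound K^L \<le> K n into L \<le> 1 + 2 g.\<close>
    moreover have "ln (real k) \<le> 2 * ln K"
    proof -
      have "2 * K \<le> K\<^sup>2" using K2 mult_right_mono[of 2 K K] by (simp add: power2_eq_square)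
      then have "K + 1 \<le> K\<^sup>2" using K2 by linarith
      then have "ln (real k) \<le> ln (K\<^sup>2)" using Kk K1 by simp
      then show ?thesis using K1 by (simp add: ln_realpow)
    qed
    then have "g * ln (real k) \<le> g * (2 * ln K)" using E0 by (intro mult_left_mono) auto
    ultimately have "real L * ln K \<le> (1 + 2 * g) * ln K" by (simp add: algebra_simps)
    then have "real L \<le> 1 + 2 * g" using K1 by simp
    then show ?thesis using E0 by simp
  qed
  have t1: "n\<^sup>2 \<le> 2 ^ t"
  proof -
    have "2 * log 2 n \<le> real t" unfolding t_def by linarith
    then have "2 powr (2 * log 2 n) \<le> 2 powr real t" by simp
    moreover have "2 powr (2 * log 2 n) = n\<^sup>2"
      using n0 by (simp add: mult.commute[of 2] flip: powr_powr)
    ultimately show ?thesis by (simp add: powr_realpow)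
  qed
  have t2: "real t \<le> 4 * ln n + 1"
  proof -
    have "ln 2 \<ge> (1/2 :: real)" using ln2_ge_two_thirds by simp
    then have "ln n / ln 2 \<le> ln n / (1/2)" using ln0 by (intro divide_left_mono) auto
    then have "log 2 n \<le> 2 * ln n" by (simp add: log_def)
    moreover have "log 2 n \<ge> 0" using n0 by simp
    ultimately show ?thesis unfolding t_def by linarith
  qed
  have D0: "D \<ge> 0" by (simp add: D_def)
  have J1: "2 * D * K\<^sup>2 * g\<^sup>2 \<le> real J" "real J \<le> 2 * D * K\<^sup>2 * g\<^sup>2 + 1"
  proof -
    have "0 \<le> 2 * D * K\<^sup>2 * g\<^sup>2" using D0 by simp
    then show "2 * D * K\<^sup>2 * g\<^sup>2 \<le> real J" "real J \<le> 2 * D * K\<^sup>2 * g\<^sup>2 + 1"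
      unfolding J_def by linarith+
  qed
  have KL2: "(K ^ L)\<^sup>2 \<le> K\<^sup>2 * n * g\<^sup>2"
  proof -
    have "(K ^ L)\<^sup>2 \<le> (K * (sqrt n * g))\<^sup>2" using KL K2 by (intro power_mono) auto
    then show ?thesis using n0 by (simp add: power_mult_distrib)
  qed
  interpret expansion_parameters k N L0 L1 L J t
  proof unfold_locales
    show "3 \<le> k" "0 < N" "L0 \<le> L1" "L1 < L" by fact+
    show "N + 2 * k * (3 * (k - 1) ^ (L + 1)) + k * k \<le> k * N"
    proof -
      have "6 * real k * K * K ^ L \<le> 6 * real k * K * (K * (sqrt n * g))"
        using KL K2 by (intro mult_left_mono) auto
      then have "n + 6 * real k * K * K ^ L + real k * real k \<le> 3 * n"
        using E4 by (simp add: power2_eq_square algebra_simps)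
      also have "\<dots> \<le> real k * n" using k n0 by simp
      finally have "real (N + 2 * k * (3 * (k - 1) ^ (L + 1)) + k * k) \<le> real (k * N)"
        by (simp add: n_def K_def mult_ac)
      then show ?thesis by (simp only: of_nat_le_iff)
    qed
    show "2 * ((3 * real (k - 1) ^ (L + 1) * real k)\<^sup>2 / real N) \<le> real J"
    proof -
      have "(3 * real (k - 1) ^ (L + 1) * real k)\<^sup>2 = (3 * K * real k)\<^sup>2 * (K ^ L)\<^sup>2"
        by (simp add: K_def power_mult_distrib)
      also have "\<dots> \<le> (3 * K * real k)\<^sup>2 * (K\<^sup>2 * n * g\<^sup>2)"
        using KL2 by (intro mult_left_mono) auto
      also have "\<dots> = D * g\<^sup>2 * n"
        by (simp add: D_def K_def power_mult_distrib power2_eq_square)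
      finally have "(3 * real (k - 1) ^ (L + 1) * real k)\<^sup>2 / real N \<le> D * g\<^sup>2"
        using n0 by (simp add: n_def divide_le_eq)
      moreover have "D * g\<^sup>2 * 1 \<le> D * g\<^sup>2 * K\<^sup>2"
        using D0 K2 by (intro mult_left_mono) (auto simp: one_le_power)
      ultimately show ?thesis using J1 by (simp add: algebra_simps)
    qed
    show "4 * L1 \<le> (k - 1) ^ L0"
    proof -
      have "real (4 * L1) \<le> K ^ L0" using L12 Lg KL0 by simp
      then have "real (4 * L1) \<le> real ((k - 1) ^ L0)" by (simp add: K_def)
      then show ?thesis by (simp only: of_nat_le_iff)
    qed
    show "8 * (L1 + L * (J + t)) \<le> (k - 1) ^ L1"
    proof -
      have "real (8 * (L1 + L * (J + t))) \<le> 8 * (real L * (1 + (real J + real t)))"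
        using L12 by (simp add: algebra_simps)
      also have "\<dots> \<le> 8 * ((3 * g) * (1 + (real J + real t)))"
        using Lg by (intro mult_left_mono mult_right_mono) auto
      also have "\<dots> = 24 * g * (1 + (real J + real t))" by simp
      also have "\<dots> \<le> 24 * g * (2 * D * K\<^sup>2 * g\<^sup>2 + 4 * ln n + 3)"
        using E0 J1 t2 by (intro mult_left_mono) auto
      also have "\<dots> \<le> K ^ L1" using E1 KL1 by linarith
      also have "\<dots> = real ((k - 1) ^ L1)" by (simp add: K_def)
      finally show ?thesis by (simp only: of_nat_le_iff)
    qed
  qed
  define r where "r = (k - 1) ^ L div 8"
  \<comment> \<open>What remains of the guaranteed boundary r after allowing for t cross edges and
    the illegal choices. It is at least sqrt n * g / 16, so s * s beats 2 t k N because g^2 outgrows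
    t.\<close>
  define s where "s = r - t - 3 * k * k"
  have r1: "8 * r \<le> (k - 1) ^ L" unfolding r_def by simp
  have "real ((k - 1) ^ L) < real (8 * (r + 1))"
    unfolding r_def of_nat_less_iff by simp
  then have "K ^ L / 8 - 1 \<le> real r" by (simp add: K_def)
  then have rs: "sqrt n * g / 16 + real t + 3 * real k * real k \<le> real r"
    using E5 t2 KL(1) unfolding power2_eq_square by linarith
  have "t + 3 * k * k \<le> r"
  proof -
    have "real (t + 3 * k * k) \<le> real r" using rs sg by simp
    then show ?thesis by (simp only: of_nat_le_iff)
  qed
  then have r2: "s + t + 3 * k * k \<le> r" and rs': "real s = real r - real t - 3 * real k * real k"
    unfolding s_def by auto
  have s1: "sqrt n * g / 16 \<le> real s" using rs rs' by simp
  then have s2: "s > 0" using sg by (metis divide_le_0_iff_numeral not_gr0 of_nat_0 not_one_le_zero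
      order_trans zero_less_numeral linorder_not_le divide_pos_pos less_le_trans zero_less_one)
  have s3: "2 * t * k * N \<le> s * s"
  proof -
    have "real (2 * t * k * N) = 2 * real t * real k * n" by (simp add: n_def)
    also have "\<dots> \<le> 2 * (4 * ln n + 1) * real k * n"
      using t2 n0 by (intro mult_right_mono mult_left_mono) auto
    also have "\<dots> \<le> g\<^sup>2 / 256 * n" using E6 n0 by (intro mult_right_mono) (auto simp: field_simps)
    also have "\<dots> = (sqrt n * g / 16)\<^sup>2" using n0 by (simp add: power_mult_distrib power_divide)
    also have "\<dots> \<le> (real s)\<^sup>2" using s1 sg by (intro power_mono) auto
    also have "\<dots> = real (s * s)" by (simp add: power2_eq_square)
    finally show ?thesis by (simp only: of_nat_le_iff)
  qed
  have half: "(1/2) ^ t \<le> 1 / n\<^sup>2"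
    using t1 n0 by (simp add: power_one_over divide_simps)
  have gam: "\<gamma> = D / n" by (simp add: \<gamma>_def D_def n_def)
  have e1: "\<gamma> * (real (k - 1) ^ 2) ^ L0 \<le> 144 * D * K\<^sup>2 * g\<^sup>2 / n"
  proof -
    have "(real (k - 1) ^ 2) ^ L0 = (K ^ L0)\<^sup>2" by (simp add: K_def mult.commute flip: power_mult)
    also have "\<dots> \<le> (K * (12 * g))\<^sup>2" using KL0 K2 by (intro power_mono) auto
    finally have "D / n * (real (k - 1) ^ 2) ^ L0 \<le> D / n * (K * (12 * g))\<^sup>2"
      using D0 n0 by (intro mult_left_mono) auto
    then show ?thesis unfolding gam by (simp add: power_mult_distrib mult_ac)
  qed
  have e2: "real L1 * (\<gamma> * (real (k - 1) ^ 2) ^ L1)\<^sup>2 \<le> 3 * g * D\<^sup>2 * K ^ 4 / (sqrt n * n)"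
  proof -
    have "(real (k - 1) ^ 2) ^ L1 = (K ^ L1)\<^sup>2" by (simp add: K_def mult.commute flip: power_mult)
    also have "\<dots> \<le> (K * n powr (1/8))\<^sup>2" using KL1 K2 by (intro power_mono) auto
    finally have "\<gamma> * (real (k - 1) ^ 2) ^ L1 \<le> D / n * (K * n powr (1/8))\<^sup>2"
      unfolding gam using D0 n0 by (intro mult_left_mono) auto
    then have "(\<gamma> * (real (k - 1) ^ 2) ^ L1)\<^sup>2 \<le> (D / n * (K * n powr (1/8))\<^sup>2)\<^sup>2"
      using gamma_nonneg by (intro power_mono) auto
    also have "\<dots> = D\<^sup>2 * K ^ 4 * (n powr (1/8)) ^ 4 / n\<^sup>2"
      by (simp add: power_mult_distrib power_divide)
    also have "(n powr (1/8)) ^ 4 = sqrt n"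
      using n0 by (simp add: powr_power powr_half_sqrt)
    also have "n\<^sup>2 = sqrt n * (sqrt n * n)" using sq by (simp add: power2_eq_square)
    also have "D\<^sup>2 * K ^ 4 * sqrt n / (sqrt n * (sqrt n * n)) = D\<^sup>2 * K ^ 4 / (sqrt n * n)"
      using sq by simp
    finally have "real L1 * (\<gamma> * (real (k - 1) ^ 2) ^ L1)\<^sup>2 \<le> (3 * g) * (D\<^sup>2 * K ^ 4 / (sqrt n * n))"
      using L12 Lg E0 by (intro mult_mono) auto
    then show ?thesis by (simp add: mult_ac)
  qed
  have e3: "real L * (1/2) ^ t \<le> 3 * g / n\<^sup>2"
    using mult_mono[OF Lg half] E0 by simp
  have "n\<^sup>2 * (2 * \<epsilon> + (1/2) ^ t)
      \<le> n\<^sup>2 * (2 * (144 * D * K\<^sup>2 * g\<^sup>2 / n + 3 * g * D\<^sup>2 * K ^ 4 / (sqrt n * n) + 3 * g / n\<^sup>2) + 1 / n\<^sup>2)"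
    unfolding \<epsilon>_def using e1 e2 e3 half by (intro mult_left_mono) auto
  also have "\<dots> = n * (288 * D * K\<^sup>2 * g\<^sup>2 + (6 * g * D\<^sup>2 * K ^ 4 / sqrt n + 6 * g / n + 1 / n))"
    using n0 sq by (simp add: field_simps power2_eq_square)
  also have "\<dots> \<le> n * (288 * D * K\<^sup>2 * g\<^sup>2 + g\<^sup>2)"
    using E9 n0 by (intro mult_left_mono) auto
  finally have eps: "n\<^sup>2 * (2 * \<epsilon> + (1/2) ^ t) \<le> n * ((288 * D * K\<^sup>2 + 1) * g\<^sup>2)"
    by (simp add: algebra_simps)
  have "(\<Sum>E\<in>regular_graphs k N. real (card (far_pairs N (2 * L + 1) E)))
      \<le> n\<^sup>2 * (2 * \<epsilon> + (1/2) ^ t) * graphs"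
    using sum_far_pairs[OF r1 r2 s3 s2] by (simp add: n_def mult.assoc)
  also have "\<dots> \<le> n * ((288 * D * K\<^sup>2 + 1) * g\<^sup>2) * graphs"
    using eps by (intro mult_right_mono) auto
  finally have A: "(\<Sum>E\<in>regular_graphs k N. real (card (far_pairs N (2 * L + 1) E)))
      \<le> n * ((288 * D * K\<^sup>2 + 1) * g\<^sup>2) * real (card (regular_graphs k N))" .
  have "9 * real (2 * L + 1 + 1) * real (k - 1) ^ (2 * L + 1) = 9 * (2 * real L + 2) * (K * (K ^ L)\<^sup>2)"
    by (simp add: K_def power_even_eq power_mult_distrib mult.commute[of 2 L] power_mult)
  also have "\<dots> \<le> 9 * (8 * g) * (K * (K\<^sup>2 * n * g\<^sup>2))"
    using Lg E0 KL2 K2 by (intro mult_mono mult_left_mono) auto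
  also have "\<dots> = 72 * K ^ 3 * n * g ^ 3" by (simp add: power2_eq_square power3_eq_cube)
  finally show ?thesis using A by blast
qed

section \<open>From expectation to high probability\<close>

lemma max_vertex_flow_le:
  assumes E: "E \<in> regular_graphs k N" and k: "k \<ge> 3" and N: "N > 0"
  shows "max_vertex_flow N E \<le> real (card (far_pairs N d E)) + 9 * real (d + 1) * real (k - 1) ^ d"
proof -
  interpret regular_graph k N E by unfold_locales fact
  show ?thesis
    unfolding max_vertex_flow_def using N vertex_flow_le[OF k] by (subst Max_le_iff) auto
qed

text \<open>Markov's inequality for a uniform element of S: outside A the value X exceeds a.\<close>

lemma prob_pmf_of_set_ge:
  fixes X :: "'a \<Rightarrow> real"
  assumes S: "finite S" "S \<noteq> {}" and X: "\<And>s. s \<in> S \<Longrightarrow> X s \<ge> 0" "(\<Sum>s\<in>S. X s) \<le> c * real (card S)" and a: "a > 0"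
    and A: "\<And>s. s \<in> S \<Longrightarrow> X s \<le> a \<Longrightarrow> s \<in> A"
  shows "measure_pmf.prob (pmf_of_set S) A \<ge> 1 - c / a"
proof -
  have "real (card (S - A)) * a = (\<Sum>s\<in>S - A. a)" by simp
  also have "\<dots> \<le> (\<Sum>s\<in>S - A. X s)" using A by (intro sum_mono) force
  also have "\<dots> \<le> (\<Sum>s\<in>S. X s)" using S X by (intro sum_mono2) auto
  finally have "real (card (S - A)) * a \<le> c * real (card S)" using X by linarith
  moreover have "card (S \<inter> A) + card (S - A) = card S"
    using S by (metis card_Int_Diff)
  then have "real (card (S - A)) = real (card S) - real (card (S \<inter> A))" by linarith
  moreover have "real (card S) > 0" using S by (simp add: card_gt_0_iff)
  ultimately show ?thesis
    using S a by (simp add: measure_pmf_of_set field_simps)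
qed

text \<open>The growth conditions of \<open>far_pairs_sparse\<close> in its order, with c for ln k
  and a for k. The last claim is the limit of the success probability.\<close>

lemma parameters_eventually:
  fixes K D c a :: real
  assumes "K > 0" "D > 0" "c > 0" "a > 0"
  defines "g \<equiv> \<lambda>N::nat. ln (real N) / c"
  shows "\<forall>\<^sub>F N in sequentially. g N \<ge> 1" "\<forall>\<^sub>F N in sequentially. g N \<le> sqrt (real N)"
    "\<forall>\<^sub>F N in sequentially. 24 * g N * (2 * D * K\<^sup>2 * (g N)\<^sup>2 + 4 * ln (real N) + 3) \<le> real N powr (1/8)"
    "\<forall>\<^sub>F N in sequentially. 12 * K * g N < real N powr (1/8)"
    "\<forall>\<^sub>F N in sequentially. K * real N powr (1/8) < sqrt (real N) * g N"
    "\<forall>\<^sub>F N in sequentially. 6 * a * K\<^sup>2 * (sqrt (real N) * g N) + a\<^sup>2 \<le> 2 * real N"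
    "\<forall>\<^sub>F N in sequentially. sqrt (real N) * g N / 16 + 1 + (4 * ln (real N) + 1) + 3 * a\<^sup>2 \<le> sqrt (real N) * g N / 8"
    "\<forall>\<^sub>F N in sequentially. 512 * (4 * ln (real N) + 1) * a \<le> (g N)\<^sup>2"
    "\<forall>\<^sub>F N in sequentially. 6 * g N * D\<^sup>2 * K ^ 4 / sqrt (real N) + 6 * g N / real N + 1 / real N \<le> (g N)\<^sup>2"
    "(\<lambda>N. 1 - H / g N) \<longlonglongrightarrow> 1"
  unfolding g_def using assms(1-4) by (-, real_asymp+)

theorem mainTheorem5:
  fixes k :: nat
  assumes "k \<ge> 3"
  shows "\<exists>C::real. \<exists>f::nat \<Rightarrow> real.
           f \<in> o(\<lambda>N. real N * (log (real k) (real N)) ^ 3) \<and>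
           ((\<lambda>N. measure_pmf.prob (pmf_of_set (regular_graphs k N))
                   {E. max_vertex_flow N E
                        \<le> real k powr C * real N * (log (real k) (real N)) ^ 3 + f N})
             \<longlongrightarrow> 1) (inf sequentially (principal {N. even (k * N)}))"
proof -
  define K where "K = real (k - 1)"
  define D where "D = (3 * real (k - 1) ^ 2 * real k)\<^sup>2"
  define g where "g = (\<lambda>N::nat. ln (real N) / ln (real k))"
  \<comment> \<open>The part 72 K^3 pays for near pairs and the 1 for the at most N g^3 far pairs
    allowed below.\<close>
  define C where "C = log (real k) (1 + 72 * K ^ 3)"
  define H where "H = 288 * D * K\<^sup>2 + 1"
  let ?P = "\<lambda>N. measure_pmf.prob (pmf_of_set (regular_graphs k N))
    {E. max_vertex_flow N E \<le> real k powr C * real N * (log (real k) (real N)) ^ 3 + 0}"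
  have K: "K > 0" using assms by (simp add: K_def)
  have kC: "real k powr C = 1 + 72 * K ^ 3"
    unfolding C_def using assms K by (intro powr_log_cancel) (auto intro: add_pos_nonneg)
  have lnk: "ln (real k) > 0" using assms by simp
  have g_log: "log (real k) (real N) = g N" for N by (simp add: g_def log_def)
  have D: "D > 0" using assms by (simp add: D_def)
  have kpos: "real k > 0" using assms by simp
  have ev: "\<forall>\<^sub>F N in sequentially. even (k * N) \<longrightarrow> 1 - H / g N \<le> ?P N"
  proof -
    note parameters_eventually(1-9)[OF K D lnk kpos]
    moreover have "\<forall>\<^sub>F N in sequentially. N > k" by (rule eventually_gt_at_top)
    ultimately show ?thesis
    proof eventually_elim
      case (elim N)
      have N: "N > 0" and g1: "g N \<ge> 1" using elim by (simp_all add: g_def)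
      obtain d where d: "9 * real (d + 1) * K ^ d \<le> 72 * K ^ 3 * real N * g N ^ 3"
        "(\<Sum>E\<in>regular_graphs k N. real (card (far_pairs N d E))) \<le> real N * (H * (g N)\<^sup>2) * real (card (regular_graphs k N))"
        using far_pairs_sparse[OF assms N, folded D_def, folded K_def, unfolded log_def, OF elim(1-9)]
        unfolding g_def H_def by blast
      show ?case
      proof
        assume "even (k * N)"
        then have ne: "regular_graphs k N \<noteq> {}" using elim by (intro regular_graphs_nonempty) auto
        have pos: "real N * g N ^ 3 > 0" using N g1 by simp
        have "max_vertex_flow N E \<le> real k powr C * real N * g N ^ 3 + 0"
          if "E \<in> regular_graphs k N" "real (card (far_pairs N d E)) \<le> real N * g N ^ 3" for E
          using max_vertex_flow_le[OF that(1) assms N, of d, folded K_def] that(2) d(1) unfolding kC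
          by (simp add: algebra_simps)
        \<comment> \<open>Markov with threshold N g^3 against mean at most H N g^2: the failure
          probability is at most H / g, which tends to 0.\<close>
        then have "1 - real N * (H * (g N)\<^sup>2) / (real N * g N ^ 3) \<le> ?P N"
          using ne d(2) pos unfolding g_log
          by (intro prob_pmf_of_set_ge[where X = "\<lambda>E. real (card (far_pairs N d E))"] finite_regular_graphs) auto
        moreover have "real N * (H * (g N)\<^sup>2) / (real N * g N ^ 3) = H / g N"
          using N g1 by (simp add: power2_eq_square power3_eq_cube)
        ultimately show "1 - H / g N \<le> ?P N" by simp
      qed
    qed
  qed
  \<comment> \<open>The limit runs over those N for which k N is even, as the handshake identity
    requires for a k-regular graph to exist.\<close>
  let ?F = "inf sequentially (principal {N. even (k * N)})"
  have "(?P \<longlongrightarrow> 1) ?F"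
  proof (rule tendsto_sandwich)
    show "\<forall>\<^sub>F N in ?F. 1 - H / g N \<le> ?P N"
      using ev by (simp add: eventually_inf_principal)
    show "\<forall>\<^sub>F N in ?F. ?P N \<le> 1" by simp
    have "((\<lambda>N. 1 - H / g N) \<longlongrightarrow> 1) sequentially"
      unfolding g_def using K D lnk kpos by (rule parameters_eventually(10))
    then show "((\<lambda>N. 1 - H / g N) \<longlongrightarrow> 1) ?F"
      by (rule tendsto_mono[rotated]) simp
  qed simp
  then show ?thesis
    by (intro exI[of _ C] exI[of _ "\<lambda>_. 0"]) simp
qed

end
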